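(* Let $K\subset\mathbb{R}^3$ be an axially symmetric constant width body, and let $C$ be its planar generating shape, viewed as a constant width shape in $\mathbb{R}^2$. Then $K$ is extreme (among constant width bodies in $\mathbb{R}^3$) if and only if $C$ is extreme (among constant width shapes in $\mathbb{R}^2$).
   Context: A convex body in $\mathbb{R}^n$ (compact convex set) has constant width if the distance between any pair of parallel supporting hyperplanes is the same; throughout, "constant width" means constant width equal to $1$. A constant width $K\subset\mathbb{R}^n$ is extreme if $K\neq(1-\lambda)K_0+\lambda K_1$ (Minkowski combination) for all $\lambda\in(0,1)$ and all constant width $K_0,K_1\subset\mathbb{R}^n$ which are not translates of each other. If $C$ is a planar constant width shape lying in a plane in $\mathbb{R}^3$ and symmetric about a line $\ell$ in that plane, then rotating $C$ about $\ell$ yields a constant width body $K\subset\mathbb{R}^3$; one says $C$ generates $K$. In coordinates where the plane is the $x_1x_3$-plane and $\ell$ is the $x_3$-axis, $K=\{x\in\mathbb{R}^3:(\sqrt{x_1^2+x_2^2},\,x_3)\in C\}$. Conversely, every constant width body in $\mathbb{R}^3$ that is axially symmetric (invariant under all rotations about some line $\ell$) arises this way from a planar constant width shape $C$ symmetric about $\ell$, its generating shape. *)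

theory Defs
  imports "HOL-Analysis.Analysis"
begin

definition supporting_hyperplane :: "'a::euclidean_space \<Rightarrow> 'a set \<Rightarrow> 'a set \<Rightarrow> bool" where
  "supporting_hyperplane u H K \<longleftrightarrow>
     (\<exists>b. H = {x. u \<bullet> x = b} \<and> K \<subseteq> {x. u \<bullet> x \<le> b} \<and> H \<inter> K \<noteq> {})"

text \<open>
  In \<open>supporting_hyperplane u H K\<close> the vector \<open>u\<close> is an outer normal. A pair of parallel
  supporting hyperplanes is a pair with opposite outer normals; specified this way, the two
  hyperplanes may coincide when the body is flat, so that flat bodies (points, for instance) do
  not satisfy the following definition vacuously. The width is normalised to be 1.
\<close>

definition constant_width :: "'a::euclidean_space set \<Rightarrow> bool" where
  "constant_width K \<longleftrightarrow> compact K \<and> convex K \<and> K \<noteq> {} \<and>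
     (\<forall>u H H'. u \<noteq> 0 \<and> supporting_hyperplane u H K \<and> supporting_hyperplane (- u) H' K
        \<longrightarrow> setdist H H' = 1)"

definition minkowski_combination :: "real \<Rightarrow> 'a::real_vector set \<Rightarrow> 'a set \<Rightarrow> 'a set" where
  "minkowski_combination t A B = {(1 - t) *\<^sub>R x + t *\<^sub>R y | x y. x \<in> A \<and> y \<in> B}"

definition translates :: "'a::ab_group_add set \<Rightarrow> 'a set \<Rightarrow> bool" where
  "translates A B \<longleftrightarrow> (\<exists>v. B = (\<lambda>x. v + x) ` A)"

definition extreme_constant_width :: "'a::euclidean_space set \<Rightarrow> bool" where
  "extreme_constant_width K \<longleftrightarrow> constant_width K \<and>
     (\<forall>t K0 K1. 0 < t \<and> t < 1 \<and> constant_width K0 \<and> constant_width K1 \<and> \<not> translates K0 K1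
        \<longrightarrow> K \<noteq> minkowski_combination t K0 K1)"

text \<open>The rotations about the line through \<open>p\<close> with direction \<open>w \<noteq> 0\<close>.\<close>

definition rotations_about :: "real^3 \<Rightarrow> real^3 \<Rightarrow> (real^3 \<Rightarrow> real^3) set" where
  "rotations_about p w = {\<lambda>x. p + Q *v (x - p) | Q. rotation_matrix Q \<and> Q *v w = w}"

definition axially_symmetric :: "(real^3) set \<Rightarrow> bool" where
  "axially_symmetric K \<longleftrightarrow> (\<exists>p w. w \<noteq> 0 \<and> (\<forall>f\<in>rotations_about p w. f ` K = K))"

text \<open>
  For orthonormal \<open>e\<close> and \<open>w\<close>, the map \<open>place p e w\<close> identifies the coordinate plane
  isometrically with the plane through \<open>p\<close> spanned by \<open>e\<close> and \<open>w\<close>, carrying the second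
  coordinate axis to the line through \<open>p\<close> with direction \<open>w\<close>.
\<close>

definition place :: "real^3 \<Rightarrow> real^3 \<Rightarrow> real^3 \<Rightarrow> real^2 \<Rightarrow> real^3" where
  "place p e w y = p + (y $ 1) *\<^sub>R e + (y $ 2) *\<^sub>R w"

definition generating_shape :: "(real^2) set \<Rightarrow> (real^3) set \<Rightarrow> bool" where
  "generating_shape C K \<longleftrightarrow>
     constant_width C \<and> (\<forall>y\<in>C. vector [- (y $ 1), y $ 2] \<in> C) \<and>
     (\<exists>p e w. norm e = 1 \<and> norm w = 1 \<and> e \<bullet> w = 0 \<and>
        K = (\<Union>f\<in>rotations_about p w. f ` place p e w ` C))"

end

theory Submission
  imports Defs
begin

text \<open>
  A body of constant width 1 is strictly convex, so it is given by its support map \<open>N\<close>, which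
  sends a unit vector \<open>u\<close> to the only point of the body with outer normal \<open>u\<close>. The maps that
  occur are those with \<open>v \<bullet> N u \<le> v \<bullet> N v\<close> and \<open>N u - N (- u) = u\<close> for unit vectors
  (\<open>constant_width_body\<close>, \<open>constant_width_imp_body\<close>). Minkowski combinations of bodies are
  pointwise combinations of support maps and translations add constants, so a body is extreme iff its
  support map is no nontrivial convex combination of others (\<open>extreme_body_iff\<close>). The support map
  of a body of revolution is the rotated support map of its generating shape
  (\<open>surface_of_revolution_eq_body\<close>).

  Let \<open>C\<close> be extreme and let \<open>K\<close> be a combination of \<open>K0\<close> and \<open>K1\<close>. Projecting to a
  plane through the axis gives a combination equal to \<open>C\<close>, so that the projections of
  \<open>K0\<close> and \<open>K1\<close> are translates. The translation vector is the projected difference of the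
  support points of \<open>K1\<close> and \<open>K0\<close> in the direction of the axis. This difference does not depend
  on the plane, so one translation moves \<open>K0\<close> to \<open>K1\<close>
  (\<open>extreme_revolve_if_extreme\<close>).

  Conversely let \<open>C\<close> be the midpoint of \<open>A\<close> and \<open>B\<close>, not translates of each other. These
  need not be symmetric, and symmetrising them can make them equal. The remedy is to cut and paste.
  A symmetric shape of constant width is determined by a quarter of its boundary, from the rightmost to
  the highest point, and this quarter can be any arc whose radius of curvature is between 0 and 1 and
  whose ends have the distances 1/2 and 0 from the axis. Up to a reflection, \<open>A\<close> and \<open>B\<close>
  differ by more than a translation over this quarter. Exchange their parts above
  a suitable height \<open>\<tau>\<close> and translate the pieces so that they fit together. The conditions on the
  curvature are local and survive (\<open>supports_on_join\<close>). The conditions on the ends amount to one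
  equation for \<open>\<tau>\<close>, solved by the intermediate value theorem. The two new symmetric shapes have
  midpoint \<open>C\<close>, and rotating them splits \<open>K\<close> (\<open>not_extreme_revolve\<close>).
\<close>

section \<open>Constant width bodies and their support maps\<close>

lemma setdist_parallel_hyperplanes:
  fixes u :: "'a::euclidean_space"
  assumes "norm u = 1"
  shows "setdist {x. u \<bullet> x = b} {x. u \<bullet> x = c} = \<bar>b - c\<bar>"
proof (rule antisym)
  have uu: "u \<bullet> u = 1" using assms by (simp add: dot_square_norm)
  have "setdist {x. u \<bullet> x = b} {x. u \<bullet> x = c} \<le> dist (b *\<^sub>R u) (c *\<^sub>R u)"
    by (rule setdist_le_dist) (auto simp: uu)
  also have "\<dots> = \<bar>b - c\<bar>"
    by (simp add: dist_norm assms flip: scaleR_diff_left)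
  finally show "setdist {x. u \<bullet> x = b} {x. u \<bullet> x = c} \<le> \<bar>b - c\<bar>" .
  show "\<bar>b - c\<bar> \<le> setdist {x. u \<bullet> x = b} {x. u \<bullet> x = c}"
  proof (rule le_setdistI)
    have "b *\<^sub>R u \<in> {x. u \<bullet> x = b}" "c *\<^sub>R u \<in> {x. u \<bullet> x = c}"
      by (auto simp: uu)
    then show "{x. u \<bullet> x = b} \<noteq> {}" "{x. u \<bullet> x = c} \<noteq> {}" by blast+
    fix x y assume "x \<in> {x. u \<bullet> x = b}" "y \<in> {x. u \<bullet> x = c}"
    then have "\<bar>b - c\<bar> = \<bar>u \<bullet> (x - y)\<bar>" by (simp add: inner_diff_right)
    also have "\<dots> \<le> dist x y"
      using Cauchy_Schwarz_ineq2[of u "x - y"] assms by (simp add: dist_norm)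
    finally show "\<bar>b - c\<bar> \<le> dist x y" .
  qed
qed

text \<open>
  This is the equality case of Cauchy-Schwarz. It turns the scalar statement that the width in
  direction \<open>u\<close> is 1, together with the diameter bound 1, into the vector identity that the
  segment joining opposite support points is \<open>u\<close> itself.
\<close>

lemma eq_unit_if_inner_eq_1:
  fixes a u :: "'a::real_inner"
  assumes "norm a \<le> 1" "norm u = 1" "u \<bullet> a = 1"
  shows "a = u"
proof -
  have "(norm (a - u))\<^sup>2 = (norm a)\<^sup>2 - 1"
    using assms by (simp add: power2_norm_eq_inner inner_diff inner_commute norm_eq_1)
  also have "\<dots> \<le> 0" using assms(1) by (simp add: power_le_one)
  finally show ?thesis by simp
qed

lemma mem_closed_convex_if_below_support:
  fixes S :: "'a::euclidean_space set"
  assumes "closed S" "convex S"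
    and "\<And>u. norm u = 1 \<Longrightarrow> \<exists>y\<in>S. u \<bullet> x \<le> u \<bullet> y"
  shows "x \<in> S"
proof (rule ccontr)
  assume "x \<notin> S"
  then obtain a b where ab: "a \<bullet> x < b" "\<And>y. y \<in> S \<Longrightarrow> b < a \<bullet> y"
    using separating_hyperplane_closed_point[of S x] assms by blast
  show False
  proof (cases "a = 0")
    case True
    obtain e :: 'a where "norm e = 1" using norm_Basis nonempty_Basis by blast
    then obtain y where "y \<in> S" using assms(3) by blast
    with ab True show False by force
  next
    case False
    then have "norm (- a /\<^sub>R norm a) = 1" by simp
    then obtain y where y: "y \<in> S" "(- a /\<^sub>R norm a) \<bullet> x \<le> (- a /\<^sub>R norm a) \<bullet> y"
      using assms(3) by blast
    then have "a \<bullet> y \<le> a \<bullet> x" using False by (simp add: field_simps)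
    with ab(1) ab(2)[OF y(1)] show False by simp
  qed
qed

text \<open>
  A support map plays the role of the inverse Gauss map of a body: \<open>N u\<close> is the boundary point
  with outer normal \<open>u\<close>. The second condition says that opposite support points are joined by a segment of length 1 orthogonal to the
  two supporting hyperplanes, which is the vector form of having width 1.
\<close>

definition support_map :: "('a::euclidean_space \<Rightarrow> 'a) \<Rightarrow> bool" where
  "support_map N \<longleftrightarrow>
     (\<forall>u v. norm u = 1 \<and> norm v = 1 \<longrightarrow> v \<bullet> N u \<le> v \<bullet> N v) \<and>
     (\<forall>u. norm u = 1 \<longrightarrow> N u - N (- u) = u)"

definition body :: "('a::euclidean_space \<Rightarrow> 'a) \<Rightarrow> 'a set" where
  "body N = {x. \<forall>u. norm u = 1 \<longrightarrow> u \<bullet> x \<le> u \<bullet> N u}"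

lemma support_mapD:
  assumes "support_map N"
  shows "norm u = 1 \<Longrightarrow> norm v = 1 \<Longrightarrow> v \<bullet> N u \<le> v \<bullet> N v"
    and "norm u = 1 \<Longrightarrow> N u - N (- u) = u"
  using assms unfolding support_map_def by auto

lemma support_map_in_body: "support_map N \<Longrightarrow> norm u = 1 \<Longrightarrow> N u \<in> body N"
  unfolding support_map_def body_def by blast

text \<open>
  The hypotheses say that \<open>N\<close> picks a support point of \<open>K\<close> for each normal; a closed
  convex set is the intersection of its supporting half-spaces.
\<close>

lemma body_eqI:
  assumes "closed K" "convex K"
    and "\<And>u. norm u = 1 \<Longrightarrow> N u \<in> K"
    and "\<And>u x. norm u = 1 \<Longrightarrow> x \<in> K \<Longrightarrow> u \<bullet> x \<le> u \<bullet> N u"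
  shows "K = body N"
proof
  show "K \<subseteq> body N" using assms(4) by (auto simp: body_def)
  show "body N \<subseteq> K"
    using assms(3) by (intro subsetI mem_closed_convex_if_below_support[OF assms(1,2)])
      (auto simp: body_def)
qed

text \<open>
  The diameter is the largest width: test the widths in the direction of the segment itself.
\<close>

lemma norm_diff_le_1_if_width_1:
  fixes x y :: "'a::euclidean_space"
  assumes "\<And>u. norm u = 1 \<Longrightarrow> u \<bullet> (x - y) \<le> 1"
  shows "norm (x - y) \<le> 1"
proof (cases "x = y")
  case False
  have "((x - y) /\<^sub>R norm (x - y)) \<bullet> (x - y) \<le> 1"
    by (rule assms) (use False in simp)
  also have "((x - y) /\<^sub>R norm (x - y)) \<bullet> (x - y) = norm (x - y)"
    using False by (simp add: dot_square_norm power2_eq_square)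
  finally show ?thesis .
qed simp

lemma norm_diff_body_le_1:
  assumes "support_map N" "x \<in> body N" "y \<in> body N"
  shows "norm (x - y) \<le> 1"
proof (rule norm_diff_le_1_if_width_1)
  fix u :: 'a assume u: "norm u = 1"
  then have "u \<bullet> x \<le> u \<bullet> N u" "- u \<bullet> y \<le> - u \<bullet> N (- u)"
    using assms(2,3) unfolding body_def mem_Collect_eq by (metis norm_minus_cancel)+
  then have "u \<bullet> (x - y) \<le> u \<bullet> (N u - N (- u))" by (simp add: inner_diff_right)
  also have "\<dots> = 1" using support_mapD(2)[OF assms(1) u] u by (simp add: norm_eq_1)
  finally show "u \<bullet> (x - y) \<le> 1" .
qed

text \<open>
  Constant width bodies are strictly convex. A point of the supporting hyperplane with normal
  \<open>u\<close> lies at distance at most 1 from the opposite support point \<open>N (- u)\<close>, while the two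
  hyperplanes are at distance 1, so it can only be the foot \<open>N (- u) + u\<close>.
\<close>

lemma support_point_unique:
  assumes "support_map N" "x \<in> body N" "norm u = 1" "u \<bullet> x = u \<bullet> N u"
  shows "x = N u"
proof -
  have d: "N u - N (- u) = u" using support_mapD(2) assms by blast
  have "x - N (- u) = u"
  proof (rule eq_unit_if_inner_eq_1)
    show "norm (x - N (- u)) \<le> 1"
      using assms by (intro norm_diff_body_le_1[of N] support_map_in_body) auto
    have "u \<bullet> (x - N (- u)) = u \<bullet> (N u - N (- u))"
      using assms(4) by (simp add: inner_diff_right)
    then show "u \<bullet> (x - N (- u)) = 1" using d assms(3) by (simp add: norm_eq_1)
  qed (rule assms(3))
  with d show ?thesis by (metis diff_add_cancel)
qed

text \<open>
  The quantities \<open>v \<bullet> M v\<close> are the values of the support function, which determine the body and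
  hence, by strict convexity, its support points.
\<close>

lemma support_map_eqI:
  assumes "support_map M" "support_map N" "norm u = 1"
    and "\<And>v. norm v = 1 \<Longrightarrow> v \<bullet> M v = v \<bullet> N v"
  shows "M u = N u"
proof -
  have "body M = body N" using assms(4) by (auto simp: body_def)
  then show ?thesis
    using support_point_unique[OF assms(2), of "M u" u] support_map_in_body[OF assms(1)] assms by auto
qed

lemma supporting_hyperplane_unit:
  assumes "u \<noteq> 0" "supporting_hyperplane u H K"
  shows "supporting_hyperplane (u /\<^sub>R norm u) H K"
proof -
  obtain b where b: "H = {x. u \<bullet> x = b}" "K \<subseteq> {x. u \<bullet> x \<le> b}" "H \<inter> K \<noteq> {}"
    using assms(2) unfolding supporting_hyperplane_def by blast
  have "H = {x. (u /\<^sub>R norm u) \<bullet> x = b / norm u}" "K \<subseteq> {x. (u /\<^sub>R norm u) \<bullet> x \<le> b / norm u}"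
    using assms(1) b(1,2) by (auto simp: field_simps)
  with b(3) show ?thesis unfolding supporting_hyperplane_def by blast
qed

lemma constant_width_body:
  assumes N: "support_map N"
  shows "constant_width (body N)"
proof -
  have eq: "body N = (\<Inter>u\<in>{u. norm u = 1}. {x. u \<bullet> x \<le> u \<bullet> N u})"
    by (auto simp: body_def)
  have "closed (body N)" unfolding eq by (intro closed_INT ballI closed_halfspace_le)
  moreover have "convex (body N)" unfolding eq by (intro convex_INT convex_halfspace_le)
  moreover obtain e :: 'a where e: "norm e = 1" using norm_Basis nonempty_Basis by blast
  then have "N e \<in> body N" using N support_map_in_body by blast
  moreover from this have "bounded (body N)"
    using norm_diff_body_le_1[OF N] unfolding bounded_def dist_norm by blast
  moreover have "setdist H H' = 1"
    if "u \<noteq> 0" and H: "supporting_hyperplane u H (body N)"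
      and H': "supporting_hyperplane (- u) H' (body N)" for u H H'
  proof -
    define v where "v = u /\<^sub>R norm u"
    have v: "norm v = 1" using that by (simp add: v_def)
    have "supporting_hyperplane v H (body N)" "supporting_hyperplane (- v) H' (body N)"
      using supporting_hyperplane_unit[OF _ H] supporting_hyperplane_unit[OF _ H'] that(1)
      by (simp_all add: v_def)
    moreover have aux: "G = {x. z \<bullet> x = z \<bullet> N z}"
      if z: "norm z = 1" and G: "supporting_hyperplane z G (body N)" for z G
    proof -
      obtain b where b: "G = {x. z \<bullet> x = b}" "body N \<subseteq> {x. z \<bullet> x \<le> b}" "G \<inter> body N \<noteq> {}"
        using G unfolding supporting_hyperplane_def by blast
      have "z \<bullet> N z \<le> b" using b(2) support_map_in_body[OF N z] by blast
      moreover have "b \<le> z \<bullet> N z" using b(1,3) z by (auto simp: body_def)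
      ultimately show ?thesis using b(1) by simp
    qed
    ultimately have "H = {x. v \<bullet> x = v \<bullet> N v}" "H' = {x. (- v) \<bullet> x = (- v) \<bullet> N (- v)}"
      using v by (metis norm_minus_cancel)+
    then have "setdist H H' = \<bar>v \<bullet> N v - v \<bullet> N (- v)\<bar>"
      using setdist_parallel_hyperplanes[OF v] by simp
    also have "\<dots> = \<bar>v \<bullet> v\<bar>"
      using support_mapD(2)[OF N v] by (metis inner_diff_right)
    finally show ?thesis using v by (simp add: norm_eq_1)
  qed
  ultimately show ?thesis
    unfolding constant_width_def compact_eq_bounded_closed by blast
qed

text \<open>
  For a body of width 1 every point lies at distance at most 1 from every other, and the difference
  of two opposite support points has component 1 along the normal; so that difference is the normal.
\<close>

lemma constant_width_imp_body:
  assumes "constant_width K"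
  obtains N where "support_map N" "K = body N"
proof -
  have K: "compact K" "convex K" "K \<noteq> {}"
    and w: "\<And>u H H'. u \<noteq> 0 \<Longrightarrow> supporting_hyperplane u H K \<Longrightarrow> supporting_hyperplane (- u) H' K
        \<Longrightarrow> setdist H H' = 1"
    using assms unfolding constant_width_def by auto
  have "\<exists>x\<in>K. \<forall>y\<in>K. u \<bullet> y \<le> u \<bullet> x" for u
    by (rule continuous_attains_sup) (use K in \<open>auto intro!: continuous_intros\<close>)
  then obtain N where N: "\<And>u. N u \<in> K" "\<And>u y. y \<in> K \<Longrightarrow> u \<bullet> y \<le> u \<bullet> N u"
    by metis
  have sup: "supporting_hyperplane u {x. u \<bullet> x = u \<bullet> N u} K" for u
    unfolding supporting_hyperplane_def using N by blast
  have width: "u \<bullet> (N u - N (- u)) = 1" if "norm u = 1" for u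
  proof -
    have "u \<noteq> 0" using that by auto
    from w[OF this sup sup] have "setdist {x. u \<bullet> x = u \<bullet> N u} {x. u \<bullet> x = u \<bullet> N (- u)} = 1"
      by simp
    then have "\<bar>u \<bullet> N u - u \<bullet> N (- u)\<bar> = 1"
      using setdist_parallel_hyperplanes[OF that] by simp
    moreover have "u \<bullet> N (- u) \<le> u \<bullet> N u" using N by blast
    ultimately show ?thesis by (simp add: inner_diff_right)
  qed
  have diff: "N u - N (- u) = u" if "norm u = 1" for u
  proof (rule eq_unit_if_inner_eq_1)
    show "norm (N u - N (- u)) \<le> 1"
    proof (rule norm_diff_le_1_if_width_1)
      fix v :: 'a assume v: "norm v = 1"
      have "v \<bullet> N u \<le> v \<bullet> N v" "- v \<bullet> N (- u) \<le> - v \<bullet> N (- v)" using N by blast+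
      with width[OF v] show "v \<bullet> (N u - N (- u)) \<le> 1" by (simp add: inner_diff_right)
    qed
  qed (use that width in auto)
  show thesis
  proof (rule that)
    show "support_map N" unfolding support_map_def using N diff by blast
    show "K = body N" using N K by (intro body_eqI) (auto intro: compact_imp_closed)
  qed
qed

lemma support_map_convex_combination:
  assumes "support_map M" "support_map N" "0 \<le> t" "t \<le> 1"
  shows "support_map (\<lambda>u. (1 - t) *\<^sub>R M u + t *\<^sub>R N u)"
  unfolding support_map_def
proof (intro conjI allI impI)
  fix u v :: 'a assume "norm u = 1 \<and> norm v = 1"
  then show "v \<bullet> ((1 - t) *\<^sub>R M u + t *\<^sub>R N u) \<le> v \<bullet> ((1 - t) *\<^sub>R M v + t *\<^sub>R N v)"
    unfolding inner_add_right inner_scaleR_right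
    using assms by (intro add_mono mult_left_mono support_mapD(1)) auto
next
  fix u :: 'a assume "norm u = 1"
  then have "M u = u + M (- u)" "N u = u + N (- u)"
    using support_mapD(2)[OF assms(1)] support_mapD(2)[OF assms(2)] by (metis diff_add_cancel)+
  then show "(1 - t) *\<^sub>R M u + t *\<^sub>R N u - ((1 - t) *\<^sub>R M (- u) + t *\<^sub>R N (- u)) = u"
    by (simp add: algebra_simps)
qed

text \<open>
  Support points add up under Minkowski combination, so that combinations of bodies become
  pointwise combinations of support maps.
\<close>

lemma minkowski_combination_body:
  assumes M: "support_map M" and N: "support_map N" and t: "0 \<le> t" "t \<le> 1"
  shows "minkowski_combination t (body M) (body N) = body (\<lambda>u. (1 - t) *\<^sub>R M u + t *\<^sub>R N u)"
proof (rule body_eqI)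
  have eq: "minkowski_combination t (body M) (body N) =
      (\<Union>x\<in>(*\<^sub>R) (1 - t) ` body M. \<Union>y\<in>(*\<^sub>R) t ` body N. {x + y})"
    unfolding minkowski_combination_def by auto
  have MN: "compact (body M)" "convex (body M)" "compact (body N)" "convex (body N)"
    using constant_width_body[OF M] constant_width_body[OF N] unfolding constant_width_def by auto
  show "convex (minkowski_combination t (body M) (body N))"
    unfolding eq by (intro convex_sums convex_scaling MN)
  have "compact {x + y |x y. x \<in> (*\<^sub>R) (1 - t) ` body M \<and> y \<in> (*\<^sub>R) t ` body N}"
    by (intro compact_sums compact_scaling MN)
  moreover have "{x + y |x y. x \<in> (*\<^sub>R) (1 - t) ` body M \<and> y \<in> (*\<^sub>R) t ` body N} =
      minkowski_combination t (body M) (body N)"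
    unfolding minkowski_combination_def by auto
  ultimately show "closed (minkowski_combination t (body M) (body N))"
    by (simp add: compact_imp_closed)
next
  fix u :: 'a assume u: "norm u = 1"
  then show "(1 - t) *\<^sub>R M u + t *\<^sub>R N u \<in> minkowski_combination t (body M) (body N)"
    unfolding minkowski_combination_def using support_map_in_body[OF M u] support_map_in_body[OF N u]
    by blast
  fix x assume "x \<in> minkowski_combination t (body M) (body N)"
  then obtain a b where ab: "a \<in> body M" "b \<in> body N" "x = (1 - t) *\<^sub>R a + t *\<^sub>R b"
    unfolding minkowski_combination_def by blast
  show "u \<bullet> x \<le> u \<bullet> ((1 - t) *\<^sub>R M u + t *\<^sub>R N u)"
    unfolding ab(3) inner_add_right inner_scaleR_right
    using ab(1,2) t u by (intro add_mono mult_left_mono) (auto simp: body_def)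
qed

text \<open>
  Translating a body changes its support function by a linear function, and conversely.
\<close>

lemma translates_body_iff:
  assumes M: "support_map M" and N: "support_map N"
  shows "translates (body M) (body N) \<longleftrightarrow> (\<exists>q. \<forall>u. norm u = 1 \<longrightarrow> u \<bullet> N u = u \<bullet> (q + M u))"
proof -
  have img: "(\<lambda>x. q + x) ` body M = body (\<lambda>u. q + M u)" for q
  proof (rule set_eqI)
    fix x
    have "x \<in> (\<lambda>x. q + x) ` body M \<longleftrightarrow> x - q \<in> body M"
      by (auto simp: image_iff) (metis add_diff_cancel_left' diff_add_cancel add.commute)+
    also have "\<dots> \<longleftrightarrow> x \<in> body (\<lambda>u. q + M u)"
      by (auto simp: body_def inner_diff_right inner_add_right algebra_simps)
    finally show "x \<in> (\<lambda>x. q + x) ` body M \<longleftrightarrow> x \<in> body (\<lambda>u. q + M u)" .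
  qed
  have qM: "support_map (\<lambda>u. q + M u)" for q
    using M unfolding support_map_def by (auto simp: inner_add_right)
  have "body N = body (\<lambda>u. q + M u) \<longleftrightarrow> (\<forall>u. norm u = 1 \<longrightarrow> u \<bullet> N u = u \<bullet> (q + M u))" for q
  proof
    assume eq: "body N = body (\<lambda>u. q + M u)"
    show "\<forall>u. norm u = 1 \<longrightarrow> u \<bullet> N u = u \<bullet> (q + M u)"
    proof (intro allI impI antisym)
      fix u :: 'a assume u: "norm u = 1"
      have "N u \<in> body (\<lambda>u. q + M u)" "q + M u \<in> body N"
        using eq support_map_in_body[OF N u] support_map_in_body[OF qM u] by auto
      with u show "u \<bullet> N u \<le> u \<bullet> (q + M u)" "u \<bullet> (q + M u) \<le> u \<bullet> N u"
        unfolding body_def by blast+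
    qed
  qed (auto simp: body_def)
  then show ?thesis unfolding translates_def img by simp
qed

text \<open>
  Extremality becomes a statement about support functions: no nontrivial convex combination of
  support maps has the support function of \<open>N\<close>, where combinations of maps whose support
  functions differ by a linear one count as trivial.
\<close>

lemma extreme_body_iff:
  assumes N: "support_map N"
  shows "extreme_constant_width (body N) \<longleftrightarrow>
    (\<forall>t M0 M1. 0 < t \<and> t < 1 \<and> support_map M0 \<and> support_map M1 \<and>
        (\<forall>u. norm u = 1 \<longrightarrow> u \<bullet> N u = u \<bullet> ((1 - t) *\<^sub>R M0 u + t *\<^sub>R M1 u))
      \<longrightarrow> (\<exists>q. \<forall>u. norm u = 1 \<longrightarrow> u \<bullet> M1 u = u \<bullet> (q + M0 u)))" (is "_ \<longleftrightarrow> ?R")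
proof
  assume L: "extreme_constant_width (body N)"
  show ?R
  proof (intro allI impI, elim conjE)
    fix t :: real and M0 M1 :: "'a \<Rightarrow> 'a"
    assume t: "0 < t" "t < 1" and M: "support_map M0" "support_map M1"
      and eq: "\<forall>u. norm u = 1 \<longrightarrow> u \<bullet> N u = u \<bullet> ((1 - t) *\<^sub>R M0 u + t *\<^sub>R M1 u)"
    have "body N = minkowski_combination t (body M0) (body M1)"
      unfolding minkowski_combination_body[OF M less_imp_le[OF t(1)] less_imp_le[OF t(2)]]
      using eq by (auto simp: body_def)
    then show "\<exists>q. \<forall>u. norm u = 1 \<longrightarrow> u \<bullet> M1 u = u \<bullet> (q + M0 u)"
      using L t constant_width_body[OF M(1)] constant_width_body[OF M(2)]
        translates_body_iff[OF M] unfolding extreme_constant_width_def by blast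
  qed
next
  assume R: ?R
  show "extreme_constant_width (body N)"
    unfolding extreme_constant_width_def
  proof (intro conjI allI impI notI, goal_cases)
    case 1
    show ?case by (rule constant_width_body[OF N])
  next
    case (2 t K0 K1)
    obtain M0 where M0: "support_map M0" "K0 = body M0" using 2 constant_width_imp_body by blast
    obtain M1 where M1: "support_map M1" "K1 = body M1" using 2 constant_width_imp_body by blast
    let ?M = "\<lambda>u. (1 - t) *\<^sub>R M0 u + t *\<^sub>R M1 u"
    have t: "0 < t" "t < 1" using 2 by auto
    then have M: "support_map ?M" using M0 M1 by (intro support_map_convex_combination) auto
    have "body N = body ?M"
      using 2 M0 M1 t by (simp add: minkowski_combination_body)
    then have "u \<bullet> N u = u \<bullet> ?M u" if "norm u = 1" for u
      using support_map_in_body[OF N that] support_map_in_body[OF M that] that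
      unfolding body_def by (intro antisym) blast+
    then have "\<exists>q. \<forall>u. norm u = 1 \<longrightarrow> u \<bullet> M1 u = u \<bullet> (q + M0 u)"
      using R t M0 M1 by blast
    then show ?case using 2 M0 M1 translates_body_iff by blast
  qed
qed

text \<open>
  The body lies in the unit ball around \<open>N (- u)\<close>, a ball that touches the supporting hyperplane
  at \<open>N u\<close>. This ball condition bounds \<open>(norm (N u - N v))\<^sup>2\<close> by
  \<open>2 * (u \<bullet> (N u - N v))\<close>; adding the condition with \<open>u\<close> and \<open>v\<close> exchanged gives
  the Lipschitz bound.
\<close>

lemma support_map_lipschitz:
  assumes N: "support_map N" and u: "norm u = 1" and v: "norm v = 1"
  shows "norm (N u - N v) \<le> norm (u - v)"
proof -
  have main: "(norm (N a - N b))\<^sup>2 \<le> 2 * (a \<bullet> (N a - N b))" if "norm a = 1" "norm b = 1" for a b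
  proof -
    have "N b - N (- a) = a - (N a - N b)"
      using support_mapD(2)[OF N that(1)] by (simp add: algebra_simps)
    moreover have "norm (N b - N (- a)) \<le> 1"
      using that by (intro norm_diff_body_le_1[OF N] support_map_in_body[OF N]) auto
    ultimately have "norm (a - (N a - N b)) \<le> 1" by metis
    then have "(norm (a - (N a - N b)))\<^sup>2 \<le> 1" by (simp add: power_le_one)
    then show ?thesis
      using that(1) by (simp only: power2_norm_eq_inner inner_diff_left inner_diff_right
          inner_commute norm_eq_1) (simp add: inner_diff_left inner_diff_right inner_commute)
  qed
  have "2 * (norm (N u - N v))\<^sup>2 \<le> 2 * (u \<bullet> (N u - N v)) + 2 * (v \<bullet> (N v - N u))"
    using main[OF u v] main[OF v u] by (simp add: norm_minus_commute)
  also have "\<dots> = 2 * ((u - v) \<bullet> (N u - N v))"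
    by (simp add: inner_diff_left inner_diff_right)
  also have "\<dots> \<le> 2 * (norm (u - v) * norm (N u - N v))"
    using norm_cauchy_schwarz by auto
  finally show ?thesis
    by (cases "N u = N v") (auto simp: power2_eq_square)
qed

section \<open>Mirror symmetry in the plane\<close>

lemma inner_real2: "x \<bullet> y = x $ 1 * y $ 1 + x $ 2 * y $ 2" for x y :: "real^2"
  by (simp add: inner_vec_def sum_2)

lemma norm_real2_eq_1: "norm x = 1 \<longleftrightarrow> (x $ 1)\<^sup>2 + (x $ 2)\<^sup>2 = 1" for x :: "real^2"
  by (simp add: norm_eq_1 inner_real2 power2_eq_square)

lemma real2_eq_iff: "x = y \<longleftrightarrow> x $ 1 = y $ 1 \<and> x $ 2 = y $ 2" for x y :: "real^2"
  by (simp add: vec_eq_iff forall_2)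

definition mirror :: "real^2 \<Rightarrow> real^2" where
  "mirror y = vector [- (y $ 1), y $ 2]"

lemma mirror_nth [simp]: "mirror y $ 1 = - (y $ 1)" "mirror y $ 2 = y $ 2"
  by (simp_all add: mirror_def)

lemma mirror_mirror [simp]: "mirror (mirror y) = y"
  by (simp add: real2_eq_iff)

lemma mirror_arith:
  "mirror (x + y) = mirror x + mirror y" "mirror (x - y) = mirror x - mirror y"
  "mirror (- x) = - mirror x" "mirror (c *\<^sub>R x) = c *\<^sub>R mirror x"
  by (simp_all add: real2_eq_iff)

lemma inner_mirror: "mirror x \<bullet> y = x \<bullet> mirror y"
  by (simp add: inner_real2)

lemma norm_mirror [simp]: "norm (mirror x) = norm x"
  by (simp add: norm_eq_sqrt_inner inner_real2)

lemma support_map_mirror: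
  assumes "support_map N"
  shows "support_map (\<lambda>u. mirror (N (mirror u)))"
  unfolding support_map_def
proof (intro conjI allI impI)
  fix u v :: "real^2" assume "norm u = 1 \<and> norm v = 1"
  then have "mirror v \<bullet> N (mirror u) \<le> mirror v \<bullet> N (mirror v)"
    using support_mapD(1)[OF assms] by simp
  then show "v \<bullet> mirror (N (mirror u)) \<le> v \<bullet> mirror (N (mirror v))" by (simp add: inner_mirror)
next
  fix u :: "real^2" assume "norm u = 1"
  then have "mirror (N (mirror u) - N (- mirror u)) = mirror (mirror u)"
    using support_mapD(2)[OF assms, of "mirror u"] by simp
  then show "mirror (N (mirror u)) - mirror (N (mirror (- u))) = u" by (simp add: mirror_arith)
qed

text \<open>
  The reflected support point is a support point for the reflected normal, and support points are
  unique.
\<close>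

lemma support_map_mirror_symmetric:
  assumes N: "support_map N" and sym: "\<And>y. y \<in> body N \<Longrightarrow> mirror y \<in> body N" and u: "norm u = 1"
  shows "N (mirror u) = mirror (N u)"
proof (rule support_point_unique[OF N, symmetric])
  show "mirror (N u) \<in> body N" using sym support_map_in_body[OF N u] .
  show "mirror u \<bullet> mirror (N u) = mirror u \<bullet> N (mirror u)"
  proof (rule antisym)
    show "mirror u \<bullet> mirror (N u) \<le> mirror u \<bullet> N (mirror u)"
      using sym[OF support_map_in_body[OF N u]] u by (auto simp: body_def)
    have "mirror (N (mirror u)) \<in> body N"
      using u by (intro sym support_map_in_body[OF N]) simp
    then have "u \<bullet> mirror (N (mirror u)) \<le> u \<bullet> N u" using u by (simp add: body_def)
    then show "mirror u \<bullet> N (mirror u) \<le> mirror u \<bullet> mirror (N u)" by (simp add: inner_mirror)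
  qed
qed (use u in simp)

section \<open>Boundary arcs over the half circle of normals\<close>

text \<open>
  The right half of the unit circle, parametrised by height. A planar body that is symmetric about
  the second coordinate axis is known from its support points for these normals, and \<open>z\<close> is the
  quantity of a normal in space that a rotation about the axis preserves.
\<close>

definition meridian :: "real \<Rightarrow> real^2" where
  "meridian z = vector [sqrt (1 - z\<^sup>2), z]"

lemma meridian_nth [simp]: "meridian z $ 1 = sqrt (1 - z\<^sup>2)" "meridian z $ 2 = z"
  by (simp_all add: meridian_def)

lemma sq_le_1: "z\<^sup>2 \<le> 1" if "z \<in> {-1..1}" for z :: real
  using that by (simp add: abs_le_square_iff[of z 1, simplified, symmetric] abs_le_iff)

lemma norm_meridian: "z \<in> {-1..1} \<Longrightarrow> norm (meridian z) = 1"
  using sq_le_1[of z] by (simp add: norm_real2_eq_1)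

text \<open>
  The cross product of two normals of the half circle is nonnegative when the first is the lower
  one: the angle increases with the height.
\<close>

lemma meridian_cross_nonneg:
  assumes "-1 \<le> s" "s \<le> m" "m \<le> 1"
  shows "s * sqrt (1 - m\<^sup>2) \<le> sqrt (1 - s\<^sup>2) * m"
proof -
  have nn: "0 \<le> sqrt (1 - m\<^sup>2)" "0 \<le> sqrt (1 - s\<^sup>2)"
    using assms sq_le_1[of s] sq_le_1[of m] by auto
  consider "0 \<le> s" | "m \<le> 0" | "s < 0" "0 < m" by linarith
  then show ?thesis
  proof cases
    case 1
    then have "s\<^sup>2 \<le> m\<^sup>2" using assms by (simp add: power_mono)
    then have "s * sqrt (1 - m\<^sup>2) \<le> m * sqrt (1 - s\<^sup>2)"
      using 1 assms nn by (intro mult_mono) auto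
    then show ?thesis by (simp add: mult.commute)
  next
    case 2
    then have "m\<^sup>2 \<le> s\<^sup>2" using assms by (simp add: abs_le_square_iff[symmetric])
    then have "(- m) * sqrt (1 - s\<^sup>2) \<le> (- s) * sqrt (1 - m\<^sup>2)"
      using 2 assms nn by (intro mult_mono) auto
    then show ?thesis by (simp add: mult.commute)
  next
    case 3
    then have "s * sqrt (1 - m\<^sup>2) \<le> 0" "0 \<le> sqrt (1 - s\<^sup>2) * m"
      using nn by (auto simp: mult_nonpos_nonneg)
    then show ?thesis by linarith
  qed
qed

lemma meridian_cross_pos:
  assumes "-1 \<le> s" "s < m" "m \<le> 1" "\<not> (s = -1 \<and> m = 1)"
  shows "s * sqrt (1 - m\<^sup>2) < sqrt (1 - s\<^sup>2) * m"
proof -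
  have "s * sqrt (1 - m\<^sup>2) \<noteq> sqrt (1 - s\<^sup>2) * m"
  proof
    assume eq: "s * sqrt (1 - m\<^sup>2) = sqrt (1 - s\<^sup>2) * m"
    then have "(s * sqrt (1 - m\<^sup>2))\<^sup>2 = (sqrt (1 - s\<^sup>2) * m)\<^sup>2" by simp
    then have "s\<^sup>2 * (1 - m\<^sup>2) = (1 - s\<^sup>2) * m\<^sup>2"
      using assms sq_le_1[of s] sq_le_1[of m] by (simp add: power_mult_distrib)
    then have "s\<^sup>2 = m\<^sup>2" by (simp add: algebra_simps)
    then have "s = - m" using assms(2) by (auto simp: power2_eq_iff)
    with eq have "m * sqrt (1 - m\<^sup>2) = 0" by simp
    then have "m = 0 \<or> m\<^sup>2 = 1" by auto
    then show False using assms \<open>s = - m\<close> by (auto simp: power2_eq_1_iff)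
  qed
  then show ?thesis using meridian_cross_nonneg[of s m] assms by linarith
qed

text \<open>
  A displacement \<open>d\<close> in the cone of tangent directions over the arc of normals from
  \<open>s\<close> to \<open>m\<close> stays in the cone when the arc is prolonged upwards. The normal at \<open>t\<close> is a
  combination of those at \<open>s\<close> and \<open>m\<close>, whose coefficients are cross products with known
  signs. Only when \<open>s\<close> and \<open>m\<close> are opposite does their cross product vanish, and then
  \<open>t = m\<close>.
\<close>

lemma meridian_inner_extend_up:
  assumes "-1 \<le> s" "s < m" "m \<le> t" "t \<le> 1"
    and "0 \<le> meridian m \<bullet> d" "meridian s \<bullet> d \<le> 0"
  shows "0 \<le> meridian t \<bullet> d"
proof (cases "s = -1 \<and> m = 1")
  case True
  then have "t = m" using assms by simp
  then show ?thesis using assms by simp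
next
  case False
  define X where "X a b = sqrt (1 - a\<^sup>2) * b - a * sqrt (1 - b\<^sup>2)" for a b :: real
  have "X s m > 0" "X s t \<ge> 0" "X m t \<ge> 0"
    using meridian_cross_pos[of s m] meridian_cross_nonneg[of s t] meridian_cross_nonneg[of m t]
      False assms by (auto simp: X_def)
  moreover have "X s m * (meridian t \<bullet> d) = X s t * (meridian m \<bullet> d) - X m t * (meridian s \<bullet> d)"
    unfolding X_def inner_real2 meridian_nth by algebra
  ultimately have "0 \<le> X s m * (meridian t \<bullet> d)"
    using assms(5,6) mult_nonneg_nonneg[of "X s t" "meridian m \<bullet> d"]
      mult_nonneg_nonpos[of "X m t" "meridian s \<bullet> d"] by linarith
  with \<open>X s m > 0\<close> show ?thesis by (simp add: zero_le_mult_iff)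
qed

lemma meridian_inner_extend_down:
  assumes "-1 \<le> t" "t \<le> m" "m < s" "s \<le> 1"
    and "0 \<le> meridian m \<bullet> d" "meridian s \<bullet> d \<le> 0"
  shows "0 \<le> meridian t \<bullet> d"
proof -
  have eq: "meridian (- z) \<bullet> (- mirror d) = meridian z \<bullet> d" for z
    by (simp add: inner_real2)
  show ?thesis
    using meridian_inner_extend_up[of "- s" "- m" "- t" "- mirror d"] assms unfolding eq by simp
qed

text \<open>
  \<open>e z\<close> is a boundary point with outer normal \<open>meridian z\<close> of the convex hull of the
  arc traced by \<open>e\<close> over \<open>I\<close>; in terms of curvature, the radius of curvature along the arc
  is nonnegative. If \<open>\<lambda>z. meridian z - e z\<close> has this property too, then the radius is at most 1.
\<close>

definition supports_on :: "real set \<Rightarrow> (real \<Rightarrow> real^2) \<Rightarrow> bool" where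
  "supports_on I e \<longleftrightarrow> (\<forall>s\<in>I. \<forall>t\<in>I. meridian t \<bullet> e s \<le> meridian t \<bullet> e t)"

lemma supports_onD: "supports_on I e \<Longrightarrow> s \<in> I \<Longrightarrow> t \<in> I \<Longrightarrow> 0 \<le> meridian t \<bullet> (e t - e s)"
  unfolding supports_on_def by (simp add: inner_diff_right)

text \<open>
  Convexity of an arc is local: displacements along the two parts lie in the tangent cones of the
  parts, hence both lie in the tangent cone of the whole. This is what makes cutting and pasting of
  boundary arcs possible.
\<close>

lemma supports_on_join:
  assumes "-1 \<le> a" "a \<le> m" "m \<le> b" "b \<le> 1"
    and L: "supports_on {a..m} e" and R: "supports_on {m..b} e"
  shows "supports_on {a..b} e"
proof -
  have up: "0 \<le> meridian t \<bullet> (e t - e s)" if "a \<le> s" "s \<le> m" "m \<le> t" "t \<le> b" for s t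
  proof (cases "s = m")
    case False
    have "0 \<le> meridian t \<bullet> (e m - e s)"
    proof (rule meridian_inner_extend_up[of s m])
      show "0 \<le> meridian m \<bullet> (e m - e s)" using supports_onD[OF L, of s m] that assms by simp
      show "meridian s \<bullet> (e m - e s) \<le> 0"
        using supports_onD[OF L, of m s] that assms by (simp add: inner_diff_right)
    qed (use that assms False in auto)
    moreover have "0 \<le> meridian t \<bullet> (e t - e m)" using supports_onD[OF R, of m t] that assms by simp
    ultimately show ?thesis by (simp add: inner_diff_right)
  qed (use that R supports_onD in auto)
  have down: "0 \<le> meridian t \<bullet> (e t - e s)" if "a \<le> t" "t \<le> m" "m \<le> s" "s \<le> b" for s t
  proof (cases "s = m")
    case False
    have "0 \<le> meridian t \<bullet> (e m - e s)"
    proof (rule meridian_inner_extend_down[of t m s])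
      show "0 \<le> meridian m \<bullet> (e m - e s)" using supports_onD[OF R, of s m] that assms by simp
      show "meridian s \<bullet> (e m - e s) \<le> 0"
        using supports_onD[OF R, of m s] that assms by (simp add: inner_diff_right)
    qed (use that assms False in auto)
    moreover have "0 \<le> meridian t \<bullet> (e t - e m)" using supports_onD[OF L, of m t] that assms by simp
    ultimately show ?thesis by (simp add: inner_diff_right)
  qed (use that L supports_onD in auto)
  show ?thesis
    unfolding supports_on_def
  proof (intro ballI)
    fix s t assume st: "s \<in> {a..b}" "t \<in> {a..b}"
    consider "s \<le> m" "t \<le> m" | "m \<le> s" "m \<le> t" | "s \<le> m" "m \<le> t" | "m \<le> s" "t \<le> m" by linarith
    then have "0 \<le> meridian t \<bullet> (e t - e s)"
      using up[of s t] down[of t s] supports_onD[OF L, of s t] supports_onD[OF R, of s t] st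
      by cases auto
    then show "meridian t \<bullet> e s \<le> meridian t \<bullet> e t" by (simp add: inner_diff_right)
  qed
qed

lemma supports_on_translate:
  assumes "supports_on I f" "\<And>z. z \<in> I \<Longrightarrow> e z = f z + k"
  shows "supports_on I e"
  using assms unfolding supports_on_def by (simp add: inner_add_right)

lemma supports_on_support_map:
  assumes "support_map M" "I \<subseteq> {-1..1}"
  shows "supports_on I (\<lambda>z. M (meridian z))"
  unfolding supports_on_def
  using assms by (intro ballI support_mapD(1)) (auto intro!: norm_meridian)

text \<open>
  In a body of width 1 the arc \<open>\<lambda>z. meridian z - M (meridian z)\<close> is the opposite boundary arc,
  turned around by the point reflection in the origin.
\<close>

lemma supports_on_complement_support_map:
  assumes M: "support_map M" and I: "I \<subseteq> {-1..1}"
  shows "supports_on I (\<lambda>z. meridian z - M (meridian z))"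
  unfolding supports_on_def
proof (intro ballI)
  fix s t assume "s \<in> I" "t \<in> I"
  then have st: "norm (meridian s) = 1" "norm (meridian t) = 1" using I norm_meridian by auto
  have eq: "u - M u = - M (- u)" if "norm u = 1" for u
    using support_mapD(2)[OF M that] by (simp add: algebra_simps)
  have "(- meridian t) \<bullet> M (- meridian s) \<le> (- meridian t) \<bullet> M (- meridian t)"
    using st by (intro support_mapD(1)[OF M]) auto
  then show "meridian t \<bullet> (meridian s - M (meridian s)) \<le> meridian t \<bullet> (meridian t - M (meridian t))"
    unfolding eq[OF st(1)] eq[OF st(2)] by simp
qed

text \<open>
  A quarter arc determines the whole right half of a symmetric shape of width 1: the support point
  with normal \<open>meridian z\<close> for negative \<open>z\<close> is opposite to the mirror image of the one for
  \<open>- z\<close>.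
\<close>

definition complete_profile :: "(real \<Rightarrow> real^2) \<Rightarrow> real \<Rightarrow> real^2" where
  "complete_profile e z =
     (if 0 \<le> z then e z else meridian z + mirror (e (- z)))"

section \<open>Bodies of revolution\<close>

definition radial :: "real^3 \<Rightarrow> real^3 \<Rightarrow> real^3" where
  "radial w u = u - (u \<bullet> w) *\<^sub>R w"

text \<open>
  The support map of the body obtained by rotating the right half \<open>e\<close> of a symmetric profile.
  On the axis, where \<open>u\<close> is \<open>w\<close> or \<open>- w\<close>, the function \<open>sgn\<close> returns 0; this is
  the correct value because a profile that closes up has radius 0 there.
\<close>

definition revolve :: "real^3 \<Rightarrow> real^3 \<Rightarrow> (real \<Rightarrow> real^2) \<Rightarrow> real^3 \<Rightarrow> real^3" where
  "revolve p w e u = p + (e (u \<bullet> w) $ 1) *\<^sub>R sgn (radial w u) + (e (u \<bullet> w) $ 2) *\<^sub>R w"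

lemma radial_minus: "radial w (- u) = - radial w u"
  by (simp add: radial_def)

lemma inner_axis_bounds: "norm u = 1 \<Longrightarrow> norm w = 1 \<Longrightarrow> u \<bullet> w \<in> {-1..1}"
  for u w :: "real^3"
  using Cauchy_Schwarz_ineq2[of u w] by (simp add: abs_le_iff)

lemma radial_orthogonal: "norm w = 1 \<Longrightarrow> radial w u \<bullet> w = 0"
  by (simp add: radial_def inner_diff_left norm_eq_1)

lemma inner_via_radial: "norm w = 1 \<Longrightarrow> u \<bullet> v = radial w u \<bullet> radial w v + (u \<bullet> w) * (v \<bullet> w)"
  by (simp add: radial_def inner_diff_left inner_diff_right norm_eq_1 inner_commute)

lemma norm_radial:
  assumes "norm u = 1" "norm w = 1"
  shows "norm (radial w u) = sqrt (1 - (u \<bullet> w)\<^sup>2)"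
proof -
  have "radial w u \<bullet> radial w u = 1 - (u \<bullet> w)\<^sup>2"
    using inner_via_radial[of w u u] assms by (simp add: norm_eq_1 power2_eq_square)
  then show ?thesis by (simp add: norm_eq_sqrt_inner)
qed

lemma norm_sgn_radial: "norm (radial w u) *\<^sub>R sgn (radial w u) = radial w u"
  by (cases "radial w u = 0") (simp_all add: sgn_div_norm)

lemma inner_sgn_self: "x \<bullet> sgn x = norm x" for x :: "'a::real_inner"
  by (cases "x = 0") (simp_all add: sgn_div_norm dot_square_norm power2_eq_square)

lemma inner_sgn_le: "x \<bullet> sgn y \<le> norm x" for x y :: "'a::real_inner"
proof -
  have "x \<bullet> sgn y \<le> norm x * norm (sgn y)" by (rule norm_cauchy_schwarz)
  also have "\<dots> \<le> norm x" by (simp add: norm_sgn)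
  finally show ?thesis .
qed

lemma inner_revolve:
  assumes w: "norm w = 1"
  shows "v \<bullet> revolve p w e u =
    v \<bullet> p + (e (u \<bullet> w) $ 1) * (radial w v \<bullet> sgn (radial w u)) + (e (u \<bullet> w) $ 2) * (v \<bullet> w)"
proof -
  have "sgn (radial w u) \<bullet> w = 0"
    using radial_orthogonal[OF w] by (simp add: sgn_div_norm)
  then have "v \<bullet> sgn (radial w u) = radial w v \<bullet> sgn (radial w u)"
    by (simp add: radial_def inner_diff_left inner_commute)
  then show ?thesis by (simp add: revolve_def inner_add_right)
qed

lemma inner_revolve_self:
  assumes w: "norm w = 1" and u: "norm u = 1"
  shows "u \<bullet> revolve p w e u = u \<bullet> p + meridian (u \<bullet> w) \<bullet> e (u \<bullet> w)"
  unfolding inner_revolve[OF w] using norm_radial[OF u w]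
  by (simp add: inner_sgn_self inner_real2)

text \<open>
  For a fixed height of \<open>u\<close>, the point of the circle of radius \<open>e z $ 1\<close> that is farthest
  in direction \<open>v\<close> lies in the half plane of \<open>v\<close>, because this radius is nonnegative. So the inequality between support points in space follows from the one in the half
  plane.
\<close>

lemma support_map_revolve:
  assumes w: "norm w = 1" and e: "supports_on {-1..1} e"
    and nonneg: "\<And>z. z \<in> {-1..1} \<Longrightarrow> 0 \<le> e z $ 1"
    and width: "\<And>z. z \<in> {-1..1} \<Longrightarrow> e z - mirror (e (- z)) = meridian z"
  shows "support_map (revolve p w e)"
  unfolding support_map_def
proof (intro conjI allI impI)
  fix u v :: "real^3" assume uv: "norm u = 1 \<and> norm v = 1"
  let ?s = "u \<bullet> w" and ?t = "v \<bullet> w"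
  have st: "?s \<in> {-1..1}" "?t \<in> {-1..1}" using uv w inner_axis_bounds by blast+
  have "e ?s $ 1 * (radial w v \<bullet> sgn (radial w u)) \<le> e ?s $ 1 * norm (radial w v)"
    by (intro mult_left_mono inner_sgn_le nonneg st)
  then have "v \<bullet> revolve p w e u \<le> v \<bullet> p + meridian ?t \<bullet> e ?s"
    using norm_radial[of v w] uv w by (simp add: inner_revolve inner_real2 mult.commute)
  also have "\<dots> \<le> v \<bullet> p + meridian ?t \<bullet> e ?t"
    using e st unfolding supports_on_def by simp
  finally show "v \<bullet> revolve p w e u \<le> v \<bullet> revolve p w e v"
    using uv w by (simp add: inner_revolve_self)
next
  fix u :: "real^3" assume u: "norm u = 1"
  let ?z = "u \<bullet> w"
  have z: "?z \<in> {-1..1}" using u w by (rule inner_axis_bounds)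
  have x: "e ?z $ 1 + e (- ?z) $ 1 = norm (radial w u)" and y: "e ?z $ 2 - e (- ?z) $ 2 = ?z"
    using arg_cong[OF width[OF z], of "\<lambda>x. x $ 1"] arg_cong[OF width[OF z], of "\<lambda>x. x $ 2"]
      norm_radial[OF u w] by simp_all
  have "revolve p w e u - revolve p w e (- u) =
      (e ?z $ 1 + e (- ?z) $ 1) *\<^sub>R sgn (radial w u) + (e ?z $ 2 - e (- ?z) $ 2) *\<^sub>R w"
    by (simp add: revolve_def radial_minus sgn_minus algebra_simps)
  also have "\<dots> = radial w u + ?z *\<^sub>R w" by (simp only: x y norm_sgn_radial)
  also have "\<dots> = u" by (simp add: radial_def)
  finally show "revolve p w e u - revolve p w e (- u) = u" .
qed

text \<open>
  Over negative heights the completed arc is built from the complement \<open>meridian z - e z\<close>, so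
  that the bound 1 on the radius of curvature of the quarter arc becomes convexity of the other
  quarter. The value 1/2 at height 0 makes the two quarters meet.
\<close>

lemma supports_on_complete_profile:
  assumes e: "supports_on {0..1} e" and e': "supports_on {0..1} (\<lambda>z. meridian z - e z)"
    and e0: "e 0 $ 1 = 1/2"
  shows "supports_on {-1..1} (complete_profile e)"
proof (rule supports_on_join[of "-1" 0 1])
  show "supports_on {0..1} (complete_profile e)"
    using e by (auto simp: supports_on_def complete_profile_def)
  show "supports_on {-1..0} (complete_profile e)"
    unfolding supports_on_def
  proof (intro ballI)
    have neg: "complete_profile e z = meridian z + mirror (e (- z))" if "z \<le> 0" for z
      using that e0 by (auto simp: complete_profile_def real2_eq_iff)
    fix s t :: real assume st: "s \<in> {-1..0}" "t \<in> {-1..0}"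
    then have "meridian (- t) \<bullet> (meridian (- s) - e (- s)) \<le> meridian (- t) \<bullet> (meridian (- t) - e (- t))"
      using e' unfolding supports_on_def by auto
    then show "meridian t \<bullet> complete_profile e s \<le> meridian t \<bullet> complete_profile e t"
      using st by (simp add: neg inner_real2 algebra_simps)
  qed
qed simp_all

text \<open>
  The arc starts and ends on the axis and is convex, so it stays on the right of the axis.
\<close>

lemma supports_on_nonneg:
  assumes e: "supports_on {-1..1} e" and pole: "e 1 $ 1 = 0" "e (-1) $ 1 = 0" and z: "z \<in> {-1..1}"
  shows "0 \<le> e z $ 1"
proof -
  have "0 \<le> sqrt (1 - z\<^sup>2) * e z $ 1"
  proof (cases "0 \<le> z")
    case True
    have "0 \<le> z * (e 1 $ 2 - e z $ 2)"
      using supports_onD[OF e, of z 1] z pole True by (simp add: inner_real2)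
    then show ?thesis
      using supports_onD[OF e, of 1 z] z pole by (simp add: inner_real2 algebra_simps)
  next
    case False
    have "e (-1) $ 2 \<le> e z $ 2"
      using supports_onD[OF e, of z "-1"] z pole by (simp add: inner_real2)
    then have "0 \<le> (- z) * (e z $ 2 - e (-1) $ 2)"
      using False by (intro mult_nonneg_nonneg) auto
    then show ?thesis
      using supports_onD[OF e, of "-1" z] z pole by (simp add: inner_real2 algebra_simps)
  qed
  moreover have "0 < sqrt (1 - z\<^sup>2) \<or> z = 1 \<or> z = -1"
    using sq_le_1[OF z] by (auto simp: power2_eq_1_iff less_le)
  ultimately show ?thesis using pole by (auto simp: zero_le_mult_iff)
qed

lemma support_map_revolve_quadrant:
  assumes "norm w = 1" "supports_on {0..1} e" "supports_on {0..1} (\<lambda>z. meridian z - e z)"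
    and e0: "e 0 $ 1 = 1/2" and e1: "e 1 $ 1 = 0"
  shows "support_map (revolve p w (complete_profile e))"
proof (rule support_map_revolve)
  show *: "supports_on {-1..1} (complete_profile e)" by (rule supports_on_complete_profile) fact+
  show "0 \<le> complete_profile e z $ 1" if "z \<in> {-1..1}" for z
    using * _ _ that by (rule supports_on_nonneg) (auto simp: complete_profile_def e1)
  show "complete_profile e z - mirror (complete_profile e (- z)) = meridian z" for z
    using e0 by (auto simp: complete_profile_def real2_eq_iff)
qed fact

lemma meridian_profile_symmetric:
  assumes N: "support_map N" and sym: "\<And>u. norm u = 1 \<Longrightarrow> N (mirror u) = mirror (N u)"
    and z: "z \<in> {-1..1}"
  shows "N (meridian z) - mirror (N (meridian (- z))) = meridian z"
proof -
  have "mirror (N (meridian (- z))) = N (mirror (meridian (- z)))"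
    using z by (intro sym[symmetric] norm_meridian) auto
  also have "mirror (meridian (- z)) = - meridian z" by (simp add: real2_eq_iff)
  finally show ?thesis using support_mapD(2)[OF N norm_meridian[OF z]] by simp
qed

text \<open>
  The width in the horizontal direction is 1 and is split evenly by the axis; the top and bottom
  support points are fixed by the reflection.
\<close>

lemma meridian_profile_special:
  assumes "support_map N" "\<And>u. norm u = 1 \<Longrightarrow> N (mirror u) = mirror (N u)"
  shows "N (meridian 0) $ 1 = 1/2" "N (meridian 1) $ 1 = 0" "N (meridian (-1)) $ 1 = 0"
proof -
  show "N (meridian 0) $ 1 = 1/2"
    using arg_cong[OF meridian_profile_symmetric[OF assms, of 0], of "\<lambda>x. x $ 1"] by simp
  have "mirror (meridian 1) = meridian 1" "mirror (meridian (-1)) = meridian (-1)"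
    by (simp_all add: real2_eq_iff)
  then have "N (meridian 1) = mirror (N (meridian 1))" "N (meridian (-1)) = mirror (N (meridian (-1)))"
    using assms(2)[of "meridian 1"] assms(2)[of "meridian (-1)"] by (simp_all add: norm_meridian)
  then show "N (meridian 1) $ 1 = 0" "N (meridian (-1)) $ 1 = 0"
    by (simp_all add: real2_eq_iff)
qed

lemma complete_profile_symmetric:
  assumes "support_map N" "\<And>u. norm u = 1 \<Longrightarrow> N (mirror u) = mirror (N u)" "z \<in> {-1..1}"
  shows "complete_profile (\<lambda>z. N (meridian z)) z = N (meridian z)"
  using meridian_profile_symmetric[OF assms] by (auto simp: complete_profile_def algebra_simps)

lemma exists_unit_orthogonal:
  fixes w :: "real^3"
  obtains e where "norm e = 1" "e \<bullet> w = 0"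
proof -
  have "dim {w} < DIM(real^3)" by simp
  then obtain x where "x \<noteq> 0" "\<And>y. y \<in> span {w} \<Longrightarrow> orthogonal x y"
    using orthogonal_to_subspace_exists by blast
  then have "norm (sgn x) = 1" "sgn x \<bullet> w = 0"
    by (auto simp: norm_sgn orthogonal_def sgn_div_norm span_base)
  then show thesis by (rule that)
qed

text \<open>
  Every \<open>u\<close> lies in a half plane bounded by the axis; its horizontal direction \<open>e\<close> is unique
  unless \<open>u\<close> is on the axis, where any unit vector orthogonal to the axis will do.
\<close>

lemma meridian_plane_exists:
  fixes u w :: "real^3"
  assumes w: "norm w = 1"
  obtains e where "norm e = 1" "e \<bullet> w = 0" "radial w u = norm (radial w u) *\<^sub>R e"
    "radial w u \<noteq> 0 \<Longrightarrow> e = sgn (radial w u)"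
proof (cases "radial w u = 0")
  case True
  obtain e where "norm e = 1" "e \<bullet> w = 0" using exists_unit_orthogonal .
  with True show thesis using that by simp
next
  case False
  show thesis
  proof (rule that[of "sgn (radial w u)"])
    show "sgn (radial w u) \<bullet> w = 0" using radial_orthogonal[OF w] by (simp add: sgn_div_norm)
  qed (use False in \<open>auto simp: norm_sgn norm_sgn_radial\<close>)
qed

text \<open>
  Rotations about an axis act transitively on the unit vectors orthogonal to it. The matrix
  \<open>P a\<close> maps the frame of \<open>a\<close>, \<open>w\<close> and their cross product to the standard frame.
\<close>

lemma rotation_about_axis_exists:
  fixes e e' w :: "real^3"
  assumes "norm e = 1" "norm e' = 1" "norm w = 1" "e \<bullet> w = 0" "e' \<bullet> w = 0"
  obtains Q where "rotation_matrix Q" "Q *v w = w" "Q *v e = e'"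
proof -
  define P where "P a = (vector [a, w, cross3 a w] :: real^3^3)" for a
  have P: "orthogonal_matrix (P a)" "det (P a) = 1" "P a *v a = vector [1,0,0]" "P a *v w = vector [0,1,0]"
    if "norm a = 1" "a \<bullet> w = 0" for a
  proof -
    have aw: "a \<bullet> a = 1" "w \<bullet> w = 1" "a \<bullet> w = 0" "w \<bullet> a = 0"
      using that assms(3) by (auto simp: norm_eq_1 inner_commute)
    have "(norm (cross3 a w))\<^sup>2 = 1" using that assms(3) by (simp add: norm_cross)
    then have cc: "cross3 a w \<bullet> cross3 a w = 1" by (simp add: power2_norm_eq_inner)
    have ca: "cross3 a w \<bullet> a = 0" "cross3 a w \<bullet> w = 0" "a \<bullet> cross3 a w = 0" "w \<bullet> cross3 a w = 0"
      by (simp_all add: inner_commute dot_cross_self)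
    have rows: "row 1 (P a) = a" "row 2 (P a) = w" "row 3 (P a) = cross3 a w"
      by (simp_all add: P_def row_def vec_eq_iff vector_3)
    show "orthogonal_matrix (P a)"
      unfolding orthogonal_matrix_orthonormal_rows
      using aw cc ca by (auto simp: forall_3 rows norm_eq_1 orthogonal_def)
    have "det (P a) = a \<bullet> cross3 w (cross3 a w)" by (simp add: P_def dot_cross_det)
    also have "cross3 w (cross3 a w) = a" using aw by (simp add: Lagrange)
    finally show "det (P a) = 1" using aw by simp
    show "P a *v a = vector [1,0,0]" "P a *v w = vector [0,1,0]"
      using aw ca
      by (simp_all add: vec_eq_iff forall_3 matrix_vector_mul_component P_def vector_3)
  qed
  show thesis
  proof (rule that)
    \<comment> \<open>first to the standard frame, then from there to the frame of the target\<close>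
    let ?Q = "transpose (P e') ** P e"
    show "rotation_matrix ?Q" unfolding rotation_matrix_def
      using P[of e] P[of e'] assms by (auto simp: orthogonal_matrix_mul orthogonal_matrix_transpose det_mul)
    have "?Q *v x = y" if "P e *v x = P e' *v y" for x y
      using that P(1)[of e'] assms unfolding orthogonal_matrix_def
      by (metis matrix_vector_mul_assoc matrix_vector_mul_lid)
    then show "?Q *v w = w" "?Q *v e = e'" using P assms by auto
  qed
qed

lemma rotation_matrix_inner:
  fixes Q :: "real^3^3"
  assumes "rotation_matrix Q"
  shows "(Q *v x) \<bullet> (Q *v y) = x \<bullet> y"
proof -
  have "orthogonal_transformation ((*v) Q)"
    using assms by (simp add: orthogonal_transformation_matrix rotation_matrix_def
        matrix_vector_mul_linear matrix_of_matrix_vector_mul)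
  then show ?thesis by (simp add: orthogonal_transformation_def)
qed

text \<open>
  For a normal \<open>u\<close>, a point of \<open>K\<close> on the circle of radius \<open>\<bar>y $ 1\<bar>\<close> is at
  best in the half plane of \<open>u\<close>, where the planar shape contains the point with coordinates
  \<open>\<bar>y $ 1\<bar>\<close> and \<open>y $ 2\<close> by symmetry. So support points of \<open>K\<close> are rotated
  support points of the planar shape.
\<close>

lemma surface_of_revolution_eq_body:
  assumes K: "closed K" "convex K"
    and N: "support_map N" and sym: "\<And>y. y \<in> body N \<Longrightarrow> mirror y \<in> body N"
    and ew: "norm e = 1" "norm w = 1" "e \<bullet> w = 0"
    and Keq: "K = (\<Union>f\<in>rotations_about p w. f ` place p e w ` body N)"
  shows "K = body (revolve p w (\<lambda>z. N (meridian z)))"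
proof (rule body_eqI[OF K])
  note symN = support_map_mirror_symmetric[OF N sym]
  have place: "p + Q *v (place p e w y - p) = p + ((y $ 1) *\<^sub>R (Q *v e) + (y $ 2) *\<^sub>R (Q *v w))" for Q y
  proof -
    have "place p e w y - p = (y $ 1) *\<^sub>R e + (y $ 2) *\<^sub>R w" by (simp add: place_def)
    then show ?thesis by (simp add: matrix_vector_right_distrib matrix_vector_mult_scaleR)
  qed
  have "x \<in> K \<longleftrightarrow> (\<exists>Q y. rotation_matrix Q \<and> Q *v w = w \<and> y \<in> body N \<and>
      x = p + Q *v (place p e w y - p))" for x
    unfolding Keq rotations_about_def by blast
  then have mem: "x \<in> K \<longleftrightarrow> (\<exists>Q y. rotation_matrix Q \<and> Q *v w = w \<and> y \<in> body N \<and>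
      x = p + ((y $ 1) *\<^sub>R (Q *v e) + (y $ 2) *\<^sub>R w))" for x
    unfolding place by (auto; metis)
  fix u :: "real^3" assume u: "norm u = 1"
  let ?z = "u \<bullet> w"
  have z: "?z \<in> {-1..1}" using u ew by (intro inner_axis_bounds)
  have nz: "norm (meridian ?z) = 1" using z by (rule norm_meridian)
  show "revolve p w (\<lambda>z. N (meridian z)) u \<in> K"
  proof -
    obtain e' where e': "norm e' = 1" "e' \<bullet> w = 0" "radial w u \<noteq> 0 \<Longrightarrow> e' = sgn (radial w u)"
      using meridian_plane_exists[OF ew(2)] by metis
    obtain Q where Q: "rotation_matrix Q" "Q *v w = w" "Q *v e = e'"
      using rotation_about_axis_exists[OF ew(1) e'(1) ew(2,3) e'(2)] .
    have "(N (meridian ?z) $ 1) *\<^sub>R sgn (radial w u) = (N (meridian ?z) $ 1) *\<^sub>R e'"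
    proof (cases "radial w u = 0")
      case True
      then have "?z = 1 \<or> ?z = -1"
        using norm_radial[OF u ew(2)] by (auto simp: power2_eq_1_iff)
      then have "N (meridian ?z) $ 1 = 0" using meridian_profile_special[OF N symN] by auto
      then show ?thesis by simp
    qed (use e' in simp)
    then have "revolve p w (\<lambda>z. N (meridian z)) u =
        p + ((N (meridian ?z) $ 1) *\<^sub>R (Q *v e) + (N (meridian ?z) $ 2) *\<^sub>R w)"
      by (simp add: revolve_def Q(3))
    then show ?thesis
      unfolding mem using Q(1,2) support_map_in_body[OF N nz] by blast
  qed
  fix x assume "x \<in> K"
  then obtain Q y where Q: "rotation_matrix Q" "Q *v w = w" and y: "y \<in> body N"
    and x: "x = p + ((y $ 1) *\<^sub>R (Q *v e) + (y $ 2) *\<^sub>R w)"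
    unfolding mem by blast
  have Qe: "norm (Q *v e) = 1" "(Q *v e) \<bullet> w = 0"
    using rotation_matrix_inner[OF Q(1), of e e] rotation_matrix_inner[OF Q(1), of e w] Q(2) ew
    by (simp_all add: norm_eq_1)
  have "\<bar>y $ 1 * (u \<bullet> (Q *v e))\<bar> \<le> \<bar>y $ 1\<bar> * norm (radial w u)"
  proof -
    have "u \<bullet> (Q *v e) = radial w u \<bullet> (Q *v e)"
      using Qe(2) inner_commute[of w "Q *v e"] by (simp add: radial_def inner_diff_left)
    then have "\<bar>u \<bullet> (Q *v e)\<bar> \<le> norm (radial w u)"
      using Cauchy_Schwarz_ineq2[of "radial w u" "Q *v e"] Qe(1) by simp
    then show ?thesis by (simp add: abs_mult mult_left_mono)
  qed
  then have "u \<bullet> x \<le> u \<bullet> p + (\<bar>y $ 1\<bar> * norm (radial w u) + y $ 2 * ?z)"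
    by (simp add: x inner_add_right)
  also have "\<dots> \<le> u \<bullet> p + meridian ?z \<bullet> N (meridian ?z)"
  proof -
    define y' where "y' = (if 0 \<le> y $ 1 then y else mirror y)"
    have "y' \<in> body N" using y sym by (simp add: y'_def)
    then have "meridian ?z \<bullet> y' \<le> meridian ?z \<bullet> N (meridian ?z)"
      using nz by (auto simp: body_def)
    moreover have "meridian ?z \<bullet> y' = \<bar>y $ 1\<bar> * norm (radial w u) + y $ 2 * ?z"
      using norm_radial[OF u ew(2)] by (simp add: y'_def inner_real2)
    ultimately show ?thesis by simp
  qed
  also have "\<dots> = u \<bullet> revolve p w (\<lambda>z. N (meridian z)) u"
    using inner_revolve_self[OF ew(2) u] by simp
  finally show "u \<bullet> x \<le> u \<bullet> revolve p w (\<lambda>z. N (meridian z)) u" .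
qed

section \<open>From an extreme shape to an extreme body\<close>

lemma norm_in_plane:
  fixes a :: "real^2" and e w :: "real^3"
  assumes "norm e = 1" "norm w = 1" "e \<bullet> w = 0"
  shows "norm ((a $ 1) *\<^sub>R e + (a $ 2) *\<^sub>R w) = norm a"
  using assms
  by (simp add: norm_eq_sqrt_inner[of a] norm_eq_sqrt_inner[of "_ + _"] inner_add_left inner_add_right
      inner_real2 inner_commute norm_eq_1)

text \<open>
  The orthogonal projection of a constant width body to a plane has constant width, and its support
  points are the projections of support points with normals in the plane. The coordinates are taken
  relative to the origin \<open>p\<close> and the orthonormal vectors \<open>e\<close> and \<open>w\<close>.
\<close>

lemma support_map_project:
  fixes e w :: "real^3"
  assumes ew: "norm e = 1" "norm w = 1" "e \<bullet> w = 0" and M: "support_map M"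
  shows "support_map (\<lambda>a::real^2. vector [e \<bullet> (M ((a $ 1) *\<^sub>R e + (a $ 2) *\<^sub>R w) - p),
    w \<bullet> (M ((a $ 1) *\<^sub>R e + (a $ 2) *\<^sub>R w) - p)])"
proof -
  define J where "J a = (a $ 1) *\<^sub>R e + (a $ 2) *\<^sub>R w" for a :: "real^2"
  define P :: "real^3 \<Rightarrow> real^2" where "P x = vector [e \<bullet> x, w \<bullet> x]" for x
  have inner: "a \<bullet> P x = J a \<bullet> x" for a x
    by (simp add: inner_real2 P_def J_def inner_add_left)
  have nJ: "norm (J a) = norm a" for a unfolding J_def by (rule norm_in_plane[OF ew])
  have Jm: "J (- a) = - J a" for a by (simp add: J_def)
  have PJ: "P (J a) = a" for a
    using ew by (simp add: real2_eq_iff P_def J_def inner_add_right inner_commute norm_eq_1)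
  have Pd: "P (x - y) = P x - P y" for x y by (simp add: real2_eq_iff P_def inner_diff_right)
  have "support_map (\<lambda>a. P (M (J a) - p))"
    unfolding support_map_def
  proof (intro conjI allI impI)
    fix a b :: "real^2" assume "norm a = 1 \<and> norm b = 1"
    then show "b \<bullet> P (M (J a) - p) \<le> b \<bullet> P (M (J b) - p)"
      unfolding inner inner_diff_right using support_mapD(1)[OF M, of "J a" "J b"] by (simp add: nJ)
  next
    fix a :: "real^2" assume "norm a = 1"
    then have "M (J a) - M (- J a) = J a" using support_mapD(2)[OF M, of "J a"] by (simp add: nJ)
    then have "P (M (J a) - M (- J a)) = a" by (simp add: PJ)
    then show "P (M (J a) - p) - P (M (J (- a)) - p) = a" by (simp add: Jm Pd)
  qed
  then show ?thesis by (simp add: P_def J_def)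
qed

text \<open>
  The body of revolution and its generating shape have the same support function in every plane
  through the axis, up to the choice of the origin \<open>p\<close>.
\<close>

lemma inner_revolve_in_plane:
  fixes a :: "real^2"
  assumes ew: "norm e = 1" "norm w = 1" "e \<bullet> w = 0"
    and sym: "\<And>u. norm u = 1 \<Longrightarrow> N (mirror u) = mirror (N u)" and a: "norm a = 1"
  defines "u \<equiv> (a $ 1) *\<^sub>R e + (a $ 2) *\<^sub>R w"
  shows "u \<bullet> revolve p w (\<lambda>z. N (meridian z)) u = u \<bullet> p + a \<bullet> N a"
proof -
  have u: "norm u = 1" using norm_in_plane[OF ew] a by (simp add: u_def)
  have uw: "u \<bullet> w = a $ 2" using ew by (simp add: u_def inner_add_left norm_eq_1)
  have "1 - (a $ 2)\<^sup>2 = (a $ 1)\<^sup>2" using a unfolding norm_real2_eq_1 by simp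
  then have mer: "meridian (a $ 2) = (if 0 \<le> a $ 1 then a else mirror a)"
    by (simp add: real2_eq_iff)
  have "meridian (a $ 2) \<bullet> N (meridian (a $ 2)) = a \<bullet> N a"
    unfolding mer using sym[OF a] by (simp add: inner_mirror)
  then show ?thesis using inner_revolve_self[OF ew(2) u] by (simp add: uw)
qed

text \<open>
  A decomposition of the body of revolution projects to a decomposition of the generating shape in
  each plane through the axis, so there the two projected summands are translates of each other. The
  translation vector can be read off from the support points with normal \<open>w\<close>, since
  \<open>w\<close> lies in each of these planes and a support point of a projection is the projection of the
  support point. Therefore the same vector \<open>M1 w - M0 w\<close> works for all planes.
\<close>

lemma extreme_revolve_if_extreme:
  assumes w: "norm w = 1" and N: "support_map N"
    and sym: "\<And>u. norm u = 1 \<Longrightarrow> N (mirror u) = mirror (N u)"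
    and W: "support_map (revolve p w (\<lambda>z. N (meridian z)))"
    and ext: "extreme_constant_width (body N)"
  shows "extreme_constant_width (body (revolve p w (\<lambda>z. N (meridian z))))"
  unfolding extreme_body_iff[OF W]
proof (intro allI impI, elim conjE)
  fix t :: real and M0 M1 :: "real^3 \<Rightarrow> real^3"
  let ?W = "revolve p w (\<lambda>z. N (meridian z))"
  assume t: "0 < t" "t < 1" and M: "support_map M0" "support_map M1"
    and comb: "\<forall>u. norm u = 1 \<longrightarrow> u \<bullet> ?W u = u \<bullet> ((1 - t) *\<^sub>R M0 u + t *\<^sub>R M1 u)"
  show "\<exists>q. \<forall>u. norm u = 1 \<longrightarrow> u \<bullet> M1 u = u \<bullet> (q + M0 u)"
  proof (intro exI allI impI)
    fix u :: "real^3" assume u: "norm u = 1"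
    obtain e where e: "norm e = 1" "e \<bullet> w = 0" and rad: "radial w u = norm (radial w u) *\<^sub>R e"
      using meridian_plane_exists[OF w] by metis
    define J where "J a = (a $ 1) *\<^sub>R e + (a $ 2) *\<^sub>R w" for a :: "real^2"
    define P :: "real^3 \<Rightarrow> real^2" where "P x = vector [e \<bullet> x, w \<bullet> x]" for x
    have inner: "a \<bullet> P x = J a \<bullet> x" for a x
      by (simp add: inner_real2 P_def J_def inner_add_left)
    have nJ: "norm (J a) = norm a" for a unfolding J_def by (rule norm_in_plane[OF e(1) w e(2)])
    define m where "m M a = P (M (J a) - p)" for M :: "real^3 \<Rightarrow> real^3" and a
    have m: "support_map (m M0)" "support_map (m M1)"
      using support_map_project[OF e(1) w e(2) M(1), of p] support_map_project[OF e(1) w e(2) M(2), of p]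
      by (simp_all add: m_def[abs_def] P_def J_def)
    have "a \<bullet> N a = a \<bullet> ((1 - t) *\<^sub>R m M0 a + t *\<^sub>R m M1 a)" if a: "norm a = 1" for a
    proof -
      have "a \<bullet> N a = J a \<bullet> ?W (J a) - J a \<bullet> p"
        using inner_revolve_in_plane[OF e(1) w e(2), of N a p, OF sym a] by (simp add: J_def)
      also have "\<dots> = a \<bullet> ((1 - t) *\<^sub>R m M0 a + t *\<^sub>R m M1 a)"
        using comb nJ[of a] a
        by (simp add: m_def inner inner_add_right inner_diff_right) (simp add: algebra_simps)
      finally show ?thesis .
    qed
    then obtain q where q: "\<And>a. norm a = 1 \<Longrightarrow> a \<bullet> m M1 a = a \<bullet> (q + m M0 a)"
      using ext t m unfolding extreme_body_iff[OF N] by metis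
    have "support_map (\<lambda>a. q + m M0 a)"
      using m(1) unfolding support_map_def by (auto simp: inner_add_right)
    from support_map_eqI[OF m(2) this _ q]
    have eq: "m M1 a = q + m M0 a" if "norm a = 1" for a using that by blast
    \<comment> \<open>\<open>meridian 1\<close> is the second coordinate vector, so this identifies \<open>q\<close> by means of the axis direction alone\<close>
    have "J (meridian 1) = w" by (simp add: J_def)
    then have "q = P (M1 w - M0 w)"
      using eq[OF norm_meridian[of 1]] by (simp add: m_def P_def real2_eq_iff inner_diff_right)
    moreover define a :: "real^2" where "a = vector [norm (radial w u), u \<bullet> w]"
    moreover have Ja: "J a = u" by (simp add: J_def a_def flip: rad) (simp add: radial_def)
    moreover have "norm a = 1" using nJ[of a] u Ja by simp
    ultimately show "u \<bullet> M1 u = u \<bullet> ((M1 w - M0 w) + M0 u)"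
      using q[of a] by (simp add: inner m_def inner_add_right inner_diff_right)
  qed
qed

section \<open>Splitting a body of revolution\<close>

text \<open>
  A point in the interior of a segment is the midpoint of a shorter segment.
\<close>

lemma not_extreme_imp_midpoint:
  fixes N :: "'a::euclidean_space \<Rightarrow> 'a"
  assumes N: "support_map N" and "\<not> extreme_constant_width (body N)"
  obtains A B where "support_map A" "support_map B"
    "\<forall>u. norm u = 1 \<longrightarrow> N u = (1/2) *\<^sub>R (A u + B u)"
    "\<forall>q. \<exists>u. norm u = 1 \<and> B u \<noteq> q + A u"
proof -
  obtain t M0 M1 where t: "0 < t" "t < 1" and M: "support_map M0" "support_map M1"
    and comb: "\<And>u. norm u = 1 \<Longrightarrow> u \<bullet> N u = u \<bullet> ((1 - t) *\<^sub>R M0 u + t *\<^sub>R M1 u)"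
    and ntr: "\<not> (\<exists>q. \<forall>u. norm u = 1 \<longrightarrow> u \<bullet> M1 u = u \<bullet> (q + M0 u))"
    using assms(2) unfolding extreme_body_iff[OF N] by blast
  \<comment> \<open>the largest step for which both \<open>t - d\<close> and \<open>t + d\<close> stay in the unit interval\<close>
  define d where "d = min t (1 - t)"
  have d: "0 < d" "d \<le> t" "t + d \<le> 1" using t by (auto simp: d_def)
  define A where "A u = (1 - (t - d)) *\<^sub>R M0 u + (t - d) *\<^sub>R M1 u" for u
  define B where "B u = (1 - (t + d)) *\<^sub>R M0 u + (t + d) *\<^sub>R M1 u" for u
  show thesis
  proof (rule that[of A B])
    show "support_map A" "support_map B"
      unfolding A_def B_def using d by (auto intro!: support_map_convex_combination[OF M])
    show "\<forall>u. norm u = 1 \<longrightarrow> N u = (1/2) *\<^sub>R (A u + B u)"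
    proof (intro allI impI)
      fix u :: 'a assume that: "norm u = 1"
      have "N u = (1 - t) *\<^sub>R M0 u + t *\<^sub>R M1 u"
        using support_map_eqI[OF N support_map_convex_combination[OF M], of t u] t comb that by auto
      moreover have "A u + B u = 2 *\<^sub>R ((1 - t) *\<^sub>R M0 u + t *\<^sub>R M1 u)"
        by (rule euclidean_eqI) (simp add: A_def B_def inner_simps algebra_simps)
      ultimately show "N u = (1/2) *\<^sub>R (A u + B u)" by simp
    qed
    show "\<forall>q. \<exists>u. norm u = 1 \<and> B u \<noteq> q + A u"
    proof (rule allI, rule ccontr)
      fix q assume "\<not> (\<exists>u. norm u = 1 \<and> B u \<noteq> q + A u)"
      then have *: "B u - A u = q" if "norm u = 1" for u
      proof -
        have "B u = q + A u" using that \<open>\<not> (\<exists>u. norm u = 1 \<and> B u \<noteq> q + A u)\<close> by blast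
        then show ?thesis by simp
      qed
      have BA: "B u - A u = (2 * d) *\<^sub>R (M1 u - M0 u)" for u
        by (rule euclidean_eqI) (simp add: A_def B_def inner_simps algebra_simps)
      have "M1 u = (1 / (2 * d)) *\<^sub>R q + M0 u" if "norm u = 1" for u
        using *[OF that] d(1) unfolding BA by auto
      with ntr show False by auto
    qed
  qed
qed

lemma unit_real2_cases:
  fixes u :: "real^2"
  assumes "norm u = 1" "0 \<le> u $ 2"
  shows "u $ 2 \<in> {0..1}" "u = meridian (u $ 2) \<or> u = mirror (meridian (u $ 2))"
proof -
  have eq: "(u $ 1)\<^sup>2 + (u $ 2)\<^sup>2 = 1" using assms(1) by (simp add: norm_real2_eq_1)
  then have "(u $ 2)\<^sup>2 \<le> 1" using zero_le_power2[of "u $ 1"] by linarith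
  then show "u $ 2 \<in> {0..1}" using assms(2) by (simp add: power_le_one_iff abs_square_le_1)
  have "1 - (u $ 2)\<^sup>2 = (u $ 1)\<^sup>2" using eq by simp
  then show "u = meridian (u $ 2) \<or> u = mirror (meridian (u $ 2))"
    by (cases "0 \<le> u $ 1") (simp_all add: real2_eq_iff)
qed

text \<open>
  The difference \<open>A - B\<close> takes the same value at opposite normals, since both maps have width
  1. So if it is constant over each of the two upper quarters, which share the normal
  \<open>meridian 1\<close>, then it is constant. If it varies over the left quarter only, reflect \<open>A\<close>
  and \<open>B\<close>; their midpoint \<open>N\<close> is unaffected.
\<close>

lemma not_extreme_imp_midpoint_quadrant:
  assumes N: "support_map N" and sym: "\<And>u. norm u = 1 \<Longrightarrow> N (mirror u) = mirror (N u)"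
    and "\<not> extreme_constant_width (body N)"
  obtains A B z where "support_map A" "support_map B"
    "\<forall>u. norm u = 1 \<longrightarrow> N u = (1/2) *\<^sub>R (A u + B u)"
    "z \<in> {0..1}" "A (meridian z) - B (meridian z) \<noteq> A (meridian 1) - B (meridian 1)"
proof -
  obtain A B where A: "support_map A" and B: "support_map B"
    and mid: "\<forall>u. norm u = 1 \<longrightarrow> N u = (1/2) *\<^sub>R (A u + B u)"
    and ntr: "\<forall>q. \<exists>u. norm u = 1 \<and> B u \<noteq> q + A u"
    using not_extreme_imp_midpoint[OF N assms(3)] .
  define D where "D u = A u - B u" for u
  define A' where "A' u = mirror (A (mirror u))" for u
  define B' where "B' u = mirror (B (mirror u))" for u
  have "\<exists>z\<in>{0..1}. D (meridian z) \<noteq> D (meridian 1) \<or> D (mirror (meridian z)) \<noteq> D (meridian 1)"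
  proof (rule ccontr)
    assume "\<not> ?thesis"
    then have Q: "D (meridian z) = D (meridian 1)" "D (mirror (meridian z)) = D (meridian 1)"
      if "z \<in> {0..1}" for z using that by blast+
    have half: "D u = D (meridian 1)" if "norm u = 1" "0 \<le> u $ 2" for u
      using unit_real2_cases(2)[OF that] Q[OF unit_real2_cases(1)[OF that]] by presburger
    have "D u = D (meridian 1)" if u: "norm u = 1" for u
    proof (cases "0 \<le> u $ 2")
      case False
      have "A u - A (- u) = B u - B (- u)"
        using support_mapD(2)[OF A u] support_mapD(2)[OF B u] by simp
      then have "D u = D (- u)" by (simp add: D_def algebra_simps)
      also have "\<dots> = D (meridian 1)" using False u by (intro half) auto
      finally show ?thesis .
    qed (use u half in blast)
    then have "B u = - D (meridian 1) + A u" if "norm u = 1" for u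
      using that by (simp add: D_def algebra_simps)
    with ntr show False by blast
  qed
  then consider z where "z \<in> {0..1}" "D (meridian z) \<noteq> D (meridian 1)"
    | z where "z \<in> {0..1}" "D (mirror (meridian z)) \<noteq> D (meridian 1)" by blast
  then show thesis
  proof cases
    case 1
    then show ?thesis using that[OF A B mid] by (simp add: D_def)
  next
    case (2 z)
    show ?thesis
    proof (rule that[of A' B' z])
      show "support_map A'" "support_map B'"
        unfolding A'_def B'_def using A B by (auto intro: support_map_mirror)
      show "\<forall>u. norm u = 1 \<longrightarrow> N u = (1/2) *\<^sub>R (A' u + B' u)"
      proof (intro allI impI)
        fix u :: "real^2" assume u: "norm u = 1"
        have "N u = mirror (N (mirror u))" using sym[OF u] by simp
        also have "\<dots> = mirror ((1/2) *\<^sub>R (A (mirror u) + B (mirror u)))" using mid u by simp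
        finally show "N u = (1/2) *\<^sub>R (A' u + B' u)" by (simp add: A'_def B'_def mirror_arith)
      qed
      have "mirror (meridian 1) = meridian 1" by (simp add: real2_eq_iff)
      then have "mirror (A' (meridian z) - B' (meridian z)) \<noteq> mirror (A' (meridian 1) - B' (meridian 1))"
        using 2(2) by (simp add: A'_def B'_def mirror_arith D_def)
      then show "A' (meridian z) - B' (meridian z) \<noteq> A' (meridian 1) - B' (meridian 1)" by metis
    qed (rule 2(1))
  qed
qed

lemma continuous_on_support_map:
  assumes "support_map N"
  shows "continuous_on (sphere 0 1) N"
proof (rule continuous_onI)
  fix x :: 'a and \<epsilon> :: real assume "x \<in> sphere 0 1" "0 < \<epsilon>"
  then show "\<exists>d>0. \<forall>y\<in>sphere 0 1. dist y x < d \<longrightarrow> dist (N y) (N x) \<le> \<epsilon>"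
    using support_map_lipschitz[OF assms]
    by (intro exI[of _ \<epsilon>]) (force simp: dist_norm intro: order_trans less_imp_le)
qed

lemma continuous_on_meridian: "continuous_on S meridian"
proof -
  have "meridian = (\<lambda>z. sqrt (1 - z\<^sup>2) *\<^sub>R axis 1 1 + z *\<^sub>R axis 2 1)"
    by (auto simp: real2_eq_iff axis_def)
  moreover have "continuous_on S (\<lambda>z. sqrt (1 - z\<^sup>2) *\<^sub>R axis 1 1 + z *\<^sub>R axis 2 1 :: real^2)"
    by (intro continuous_intros)
  ultimately show ?thesis by metis
qed

lemma continuous_on_support_map_meridian:
  assumes "support_map M"
  shows "continuous_on {0..1} (\<lambda>z. M (meridian z))"
  by (rule continuous_on_compose2[OF continuous_on_support_map[OF assms] continuous_on_meridian])
    (auto simp: norm_meridian)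

lemma midvalue_attained:
  fixes f :: "real \<Rightarrow> real"
  assumes "continuous_on {0..1} f"
  obtains \<tau> where "\<tau> \<in> {0..1}" "f \<tau> = (f 0 + f 1) / 2"
proof (cases "f 0 \<le> f 1")
  case True
  then show thesis using IVT'[of f 0 "(f 0 + f 1) / 2" 1] assms that by auto
next
  case False
  then show thesis using IVT2'[of f 1 "(f 0 + f 1) / 2" 0] assms that by auto
qed

text \<open>
  A quarter arc that follows one constant width shape up to height \<open>\<tau>\<close> and a translate of
  another one above \<open>\<tau>\<close> has radius of curvature between 0 and 1. Agreement of both
  descriptions at \<open>\<tau>\<close> is part of the hypotheses. If the arc ends at the right distances from
  the axis, its completion can be rotated.
\<close>

lemma support_map_revolve_splice:
  assumes w: "norm w = 1" and PQ: "support_map P" "support_map Q" and \<tau>: "\<tau> \<in> {0..1}"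
    and P: "\<And>z. z \<in> {0..\<tau>} \<Longrightarrow> e z = P (meridian z) + k"
    and Q: "\<And>z. z \<in> {\<tau>..1} \<Longrightarrow> e z = Q (meridian z) + l"
    and ends: "e 0 $ 1 = 1/2" "e 1 $ 1 = 0"
  shows "support_map (revolve p w (complete_profile e))"
proof (rule support_map_revolve_quadrant[OF w _ _ ends])
  have sub: "{0..\<tau>} \<subseteq> {-1..1}" "{\<tau>..1} \<subseteq> {-1..1}" using \<tau> by auto
  show "supports_on {0..1} e"
  proof (rule supports_on_join[of 0 \<tau> 1])
    show "supports_on {0..\<tau>} e"
      by (rule supports_on_translate[OF supports_on_support_map[OF PQ(1) sub(1)] P])
    show "supports_on {\<tau>..1} e"
      by (rule supports_on_translate[OF supports_on_support_map[OF PQ(2) sub(2)] Q])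
  qed (use \<tau> in auto)
  show "supports_on {0..1} (\<lambda>z. meridian z - e z)"
  proof (rule supports_on_join[of 0 \<tau> 1])
    show "supports_on {0..\<tau>} (\<lambda>z. meridian z - e z)"
      by (rule supports_on_translate[OF supports_on_complement_support_map[OF PQ(1) sub(1)], of _ "- k"])
        (simp add: P)
    show "supports_on {\<tau>..1} (\<lambda>z. meridian z - e z)"
      by (rule supports_on_translate[OF supports_on_complement_support_map[OF PQ(2) sub(2)], of _ "- l"])
        (simp add: Q)
  qed (use \<tau> in auto)
qed

text \<open>
  Write the planar shape as midpoint of \<open>A\<close> and \<open>B\<close>, that is as \<open>N + D\<close> and
  \<open>N - D\<close> over a quarter circle where \<open>D\<close> is not constant. The shapes \<open>A\<close> and
  \<open>B\<close> need not be symmetric, so they cannot be rotated. Two arcs are made from them by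
  exchanging their upper parts at height \<open>\<tau>\<close>: one follows \<open>A\<close> below and \<open>B\<close> above,
  the other one follows \<open>B\<close> below and \<open>A\<close> above. They are \<open>N + \<sigma>\<close> and
  \<open>N - \<sigma>\<close>, where \<open>\<sigma>\<close> equals \<open>D\<close> up to a constant below \<open>\<tau>\<close> and
  \<open>- D\<close> up to a constant above. To be completed to symmetric shapes, both arcs must start and
  end at the same distance from the axis as \<open>N\<close>. With the constants chosen so that
  \<open>\<sigma>\<close> is continuous and starts right, it ends right exactly if the first coordinate of
  \<open>D \<tau>\<close> is the mean of those of \<open>D 0\<close> and \<open>D 1\<close>, and such a \<open>\<tau>\<close> exists by
  the intermediate value theorem.
\<close>

lemma not_extreme_revolve:
  assumes w: "norm w = 1" and N: "support_map N"
    and sym: "\<And>u. norm u = 1 \<Longrightarrow> N (mirror u) = mirror (N u)"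
    and W: "support_map (revolve p w (\<lambda>z. N (meridian z)))"
    and nonext: "\<not> extreme_constant_width (body N)"
  shows "\<not> extreme_constant_width (body (revolve p w (\<lambda>z. N (meridian z))))"
proof -
  obtain A B z0 where A: "support_map A" and B: "support_map B"
    and mid: "\<forall>u. norm u = 1 \<longrightarrow> N u = (1/2) *\<^sub>R (A u + B u)"
    and z0: "z0 \<in> {0..1}" "A (meridian z0) - B (meridian z0) \<noteq> A (meridian 1) - B (meridian 1)"
    using not_extreme_imp_midpoint_quadrant[OF N sym nonext] .
  define D where "D z = (1/2) *\<^sub>R (A (meridian z) - B (meridian z))" for z
  have ND: "A (meridian z) = N (meridian z) + D z" "B (meridian z) = N (meridian z) - D z"
    if "z \<in> {0..1}" for z
  proof -
    have "N (meridian z) = (1/2) *\<^sub>R (A (meridian z) + B (meridian z))"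
      using mid that by (simp add: norm_meridian)
    then show "A (meridian z) = N (meridian z) + D z" "B (meridian z) = N (meridian z) - D z"
      by (simp_all add: real2_eq_iff D_def field_simps)
  qed
  have "continuous_on {0..1} (\<lambda>z. D z $ 1)"
    unfolding D_def using A B
    by (intro continuous_intros continuous_on_support_map_meridian)
  then obtain \<tau> where \<tau>: "\<tau> \<in> {0..1}" "D \<tau> $ 1 = (D 0 $ 1 + D 1 $ 1) / 2"
    using midvalue_attained by blast
  \<comment> \<open>the value of \<open>\<sigma>\<close> at the cut: its first coordinate makes \<open>\<sigma>\<close> vanish horizontally at both ends, its second one is free\<close>
  define \<kappa> :: "real^2" where "\<kappa> = vector [(D 1 $ 1 - D 0 $ 1) / 2, 0]"
  define \<sigma> where "\<sigma> z = (if z \<le> \<tau> then D z - D \<tau> else D \<tau> - D z) + \<kappa>" for z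
  have \<sigma>_low: "\<sigma> z = D z + (\<kappa> - D \<tau>)" if "z \<in> {0..\<tau>}" for z
    using that by (simp add: \<sigma>_def)
  have \<sigma>_high: "\<sigma> z = - D z + (\<kappa> + D \<tau>)" if "z \<in> {\<tau>..1}" for z
    using that by (cases "z = \<tau>") (auto simp: \<sigma>_def)
  have \<sigma>_ends: "\<sigma> 0 $ 1 = 0" "\<sigma> 1 $ 1 = 0"
  proof -
    have "\<sigma> 0 = D 0 + (\<kappa> - D \<tau>)" "\<sigma> 1 = - D 1 + (\<kappa> + D \<tau>)"
      using \<sigma>_low[of 0] \<sigma>_high[of 1] \<tau>(1) by auto
    moreover have "\<kappa> $ 1 = (D 1 $ 1 - D 0 $ 1) / 2" by (simp add: \<kappa>_def)
    ultimately show "\<sigma> 0 $ 1 = 0" "\<sigma> 1 $ 1 = 0"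
      unfolding vec_eq_iff forall_2 vector_add_component vector_minus_component
        vector_uminus_component using \<tau>(2) by argo+
  qed
  note N_ends = meridian_profile_special[OF N sym]
  define R where "R s = revolve p w (complete_profile (\<lambda>z. N (meridian z) + s *\<^sub>R \<sigma> z))" for s :: real
  have R: "support_map (R 1)" "support_map (R (-1))"
  proof -
    show "support_map (R 1)"
      unfolding R_def
    proof (rule support_map_revolve_splice[OF w A B \<tau>(1)])
      show "N (meridian z) + 1 *\<^sub>R \<sigma> z = A (meridian z) + (\<kappa> - D \<tau>)" if "z \<in> {0..\<tau>}" for z
        using that \<tau>(1) by (simp add: ND(1) \<sigma>_low[OF that])
      show "N (meridian z) + 1 *\<^sub>R \<sigma> z = B (meridian z) + (\<kappa> + D \<tau>)" if "z \<in> {\<tau>..1}" for z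
        using that \<tau>(1) by (simp add: ND(2) \<sigma>_high[OF that])
    qed (simp_all add: \<sigma>_ends N_ends)
    show "support_map (R (-1))"
      unfolding R_def
    proof (rule support_map_revolve_splice[OF w B A \<tau>(1)])
      show "N (meridian z) + (-1) *\<^sub>R \<sigma> z = B (meridian z) + (D \<tau> - \<kappa>)" if "z \<in> {0..\<tau>}" for z
        using that \<tau>(1) by (simp add: ND(2) \<sigma>_low[OF that])
      show "N (meridian z) + (-1) *\<^sub>R \<sigma> z = A (meridian z) + (- \<kappa> - D \<tau>)" if "z \<in> {\<tau>..1}" for z
        using that \<tau>(1) by (simp add: ND(1) \<sigma>_high[OF that])
    qed (simp_all add: \<sigma>_ends N_ends)
  qed
  let ?W = "revolve p w (\<lambda>z. N (meridian z))"
  have comb: "u \<bullet> ?W u = u \<bullet> ((1 - 1/2) *\<^sub>R R (-1) u + (1/2) *\<^sub>R R 1 u)" if u: "norm u = 1" for u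
  proof -
    let ?z = "u \<bullet> w"
    let ?C = "\<lambda>s. complete_profile (\<lambda>z. N (meridian z) + s *\<^sub>R \<sigma> z) ?z"
    have z: "?z \<in> {-1..1}" by (rule inner_axis_bounds[OF u w])
    have "N (meridian ?z) = (1/2) *\<^sub>R (?C (-1) + ?C 1)"
      using complete_profile_symmetric[OF N sym z]
      by (auto simp: complete_profile_def real2_eq_iff)
    then have "meridian ?z \<bullet> N (meridian ?z) = (1/2) * (meridian ?z \<bullet> ?C (-1) + meridian ?z \<bullet> ?C 1)"
      by (simp add: inner_add_right)
    then show ?thesis
      unfolding inner_add_right inner_scaleR_right R_def inner_revolve_self[OF w u]
      by (simp add: field_simps)
  qed
  have "\<not> (\<exists>q. \<forall>u. norm u = 1 \<longrightarrow> u \<bullet> R 1 u = u \<bullet> (q + R (-1) u))"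
  proof
    assume "\<exists>q. \<forall>u. norm u = 1 \<longrightarrow> u \<bullet> R 1 u = u \<bullet> (q + R (-1) u)"
    then obtain q where q: "\<And>u. norm u = 1 \<Longrightarrow> u \<bullet> R 1 u = u \<bullet> (q + R (-1) u)" by blast
    have "support_map (\<lambda>u. q + R (-1) u)"
      using R(2) unfolding support_map_def by (auto simp: inner_add_right)
    from support_map_eqI[OF R(1) this _ q]
    have eq: "R 1 u = q + R (-1) u" if "norm u = 1" for u using that by blast
    obtain e where e: "norm e = 1" "e \<bullet> w = 0" using exists_unit_orthogonal .
    have ew: "e \<bullet> e = 1" "w \<bullet> w = 1" "w \<bullet> e = 0" using e w by (simp_all add: norm_eq_1 inner_commute)
    \<comment> \<open>The difference of the two rotated support maps is \<open>2 * \<sigma> z\<close>, placed in the half plane of the normal. At the pole the direction \<open>e\<close> is arbitrary, but there the first coordinate of \<open>\<sigma>\<close> vanishes.\<close>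
    have q_eq: "q = (2 * \<sigma> z $ 1) *\<^sub>R e + (2 * \<sigma> z $ 2) *\<^sub>R w" if z: "z \<in> {0..1}" for z
    proof -
      define u where "u = sqrt (1 - z\<^sup>2) *\<^sub>R e + z *\<^sub>R w"
      have "norm u = norm (meridian z)"
        using norm_in_plane[OF e(1) w e(2), of "meridian z"] by (simp add: u_def)
      then have u: "norm u = 1" using z norm_meridian[of z] by simp
      have uw: "u \<bullet> w = z" using e(2) ew by (simp add: u_def inner_add_left)
      have "radial w u = sqrt (1 - z\<^sup>2) *\<^sub>R e" by (simp add: radial_def uw) (simp add: u_def)
      moreover have "0 < sqrt (1 - z\<^sup>2) \<or> z = 1"
        using sq_le_1[of z] z by (auto simp: power2_eq_1_iff less_le)
      ultimately have "\<sigma> z $ 1 *\<^sub>R sgn (radial w u) = \<sigma> z $ 1 *\<^sub>R e"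
        using e(1) by (auto simp: sgn_scaleR sgn_div_norm[of e] \<sigma>_ends)
      moreover have "q = R 1 u - R (-1) u" using eq[OF u] by simp
      moreover have "\<dots> = (2 * \<sigma> z $ 1) *\<^sub>R sgn (radial w u) + (2 * \<sigma> z $ 2) *\<^sub>R w"
      proof -
        have Rs: "R s u = p + (N (meridian z) $ 1 + s * \<sigma> z $ 1) *\<^sub>R sgn (radial w u)
            + (N (meridian z) $ 2 + s * \<sigma> z $ 2) *\<^sub>R w" for s
          using z by (simp add: R_def revolve_def uw complete_profile_def)
        show ?thesis unfolding Rs by (simp add: algebra_simps scaleR_2 flip: scaleR_scaleR)
      qed
      ultimately show ?thesis by (simp flip: scaleR_scaleR)
    qed
    have \<sigma>_const: "\<sigma> z = (1/2) *\<^sub>R vector [q \<bullet> e, q \<bullet> w]" if "z \<in> {0..1}" for z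
      using ew e(2) by (simp add: q_eq[OF that] real2_eq_iff inner_add_left)
    have "\<sigma> \<tau> = \<kappa>" by (simp add: \<sigma>_def)
    moreover have "\<sigma> \<tau> = \<sigma> 0" using \<sigma>_const[OF \<tau>(1)] \<sigma>_const[of 0] by simp
    ultimately have "\<kappa> = 0" using \<sigma>_ends by (auto simp: real2_eq_iff \<kappa>_def)
    \<comment> \<open>a constant \<open>\<sigma>\<close> that vanishes at the cut vanishes everywhere, and away from the cut it is \<open>D\<close> up to sign and constant\<close>
    have "D z = D \<tau>" if "z \<in> {0..1}" for z
    proof -
      have "\<sigma> z = 0" using \<sigma>_const[OF that] \<sigma>_const[OF \<tau>(1)] \<open>\<sigma> \<tau> = \<kappa>\<close> \<open>\<kappa> = 0\<close> by simp
      then show ?thesis using \<open>\<kappa> = 0\<close> by (auto simp: \<sigma>_def split: if_splits)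
    qed
    from this[OF z0(1)] this[of 1] have "D z0 = D 1" by simp
    with z0(2) show False by (simp add: D_def)
  qed
  with R comb show ?thesis
    unfolding extreme_body_iff[OF W]
    by (intro notI, elim allE[of _ "1/2"] allE[of _ "R (-1)"] allE[of _ "R 1"]) auto
qed

section \<open>Extreme bodies of revolution\<close>

theorem theoremC:
  fixes K :: "(real^3) set" and C :: "(real^2) set"
  assumes "constant_width K"
    and "axially_symmetric K"
    and "generating_shape C K"
  shows "extreme_constant_width K \<longleftrightarrow> extreme_constant_width C"
proof -
  obtain p e w where C: "constant_width C" "\<And>y. y \<in> C \<Longrightarrow> mirror y \<in> C"
    and ew: "norm e = 1" "norm w = 1" "e \<bullet> w = 0"
    and Keq: "K = (\<Union>f\<in>rotations_about p w. f ` place p e w ` C)"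
    using assms(3) unfolding generating_shape_def mirror_def by blast
  obtain N where N: "support_map N" "C = body N" using C(1) constant_width_imp_body by blast
  have K: "closed K" "convex K"
    using assms(1) by (auto simp: constant_width_def compact_imp_closed)
  let ?W = "revolve p w (\<lambda>z. N (meridian z))"
  have sym: "y \<in> body N \<Longrightarrow> mirror y \<in> body N" for y using C(2) N(2) by blast
  note symN = support_map_mirror_symmetric[OF N(1) sym]
  have KW: "K = body ?W"
    using surface_of_revolution_eq_body[OF K N(1) sym ew] Keq N(2) by blast
  have W: "support_map ?W"
  proof (rule support_map_revolve[OF ew(2)])
    show *: "supports_on {-1..1} (\<lambda>z. N (meridian z))"
      by (rule supports_on_support_map[OF N(1)]) simp
    show "0 \<le> N (meridian z) $ 1" if "z \<in> {-1..1}" for z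
      using supports_on_nonneg[OF *] meridian_profile_special[OF N(1) symN] that by blast
    show "N (meridian z) - mirror (N (meridian (- z))) = meridian z" if "z \<in> {-1..1}" for z
      by (rule meridian_profile_symmetric[OF N(1) symN that])
  qed
  show ?thesis
    unfolding KW N(2)
    using extreme_revolve_if_extreme[OF ew(2) N(1) symN W] not_extreme_revolve[OF ew(2) N(1) symN W]
    by blast
qed

end
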